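(* Let $(X,T)$ be a topological dynamical system, where $X$ is a non-empty compact metric space with metric $d$ and $T:X\to X$ is continuous, and let $m\in M(X)$. Then the following statements are equivalent: (1) $(X,T)$ has a physical measure with respect to $m$; (2) $(m\times m)\big(N(F)\cap(Q\times Q)\big)>0$; (3) $(m\times m)\big(N(\underline F)\cap(Q\times Q)\big)>0$.
   Context: $M(X)$ is the set of all regular Borel probability measures on $X$, with the weak$^*$ topology, and $M(X,T)$ is the set of $T$-invariant ones; $m$ need not be $T$-invariant. A measure $\mu\in M(X,T)$ is a physical measure with respect to $m$ if $m(B(\mu))>0$, where $B(\mu)=\{x\in X:\lim_{n\to+\infty}\frac1n\sum_{k=1}^n\delta_{T^kx}=\mu\}$ (weak$^*$ limit) and $\delta_y$ is the Dirac measure at $y$. A point $x\in X$ is generic if $\lim_{n\to+\infty}\frac1n\sum_{k=1}^n f(T^kx)$ exists for every continuous function $f$ on $X$; $Q$ is the set of all generic points (a Borel set). $S_n$ denotes the group of permutations of $\{1,\dots,n\}$. For $x,y\in X$ define $\overline F(x,y)=\limsup_{n\to+\infty}\inf_{\sigma\in S_n}\frac1n\sum_{k=1}^n d(T^kx,T^{\sigma(k)}y)$ and $\underline F(x,y)=\liminf_{n\to+\infty}\inf_{\sigma\in S_n}\frac1n\sum_{k=1}^n d(T^kx,T^{\sigma(k)}y)$. If $\overline F(x,y)=\underline F(x,y)$, we say $F(x,y)$ exists and denote the common value by $F(x,y)$. $N(F)=\{(x,y)\in X\times X : F(x,y)\text{ exists and } F(x,y)=0\}$ and $N(\underline F)=\{(x,y)\in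 X\times X:\underline F(x,y)=0\}$. *)

theory Defs
  imports "HOL-Probability.Probability" "HOL-Combinatorics.Permutations"
begin

text \<open>The space \<open>X\<close> is the universe of a type of class \<^class>\<open>metric_space\<close>, its metric is
  \<^const>\<open>dist\<close>, and compactness appears as the explicit hypothesis \<open>compact UNIV\<close>.\<close>

definition regular_borel_measure :: "'a::topological_space measure \<Rightarrow> bool" where
  "regular_borel_measure \<mu> \<longleftrightarrow> sets \<mu> = sets borel \<and>
     (\<forall>A\<in>sets borel.
        emeasure \<mu> A = (SUP K\<in>{K. K \<subseteq> A \<and> compact K}. emeasure \<mu> K) \<and>
        emeasure \<mu> A = (INF U\<in>{U. A \<subseteq> U \<and> open U}. emeasure \<mu> U))"

definition prob_measures :: "'a::topological_space measure set" where
  "prob_measures = {\<mu>. prob_space \<mu> \<and> regular_borel_measure \<mu>}"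

definition invariant_measures :: "('a::topological_space \<Rightarrow> 'a) \<Rightarrow> 'a measure set" where
  "invariant_measures T =
     {\<mu> \<in> prob_measures. \<forall>A\<in>sets borel. emeasure \<mu> (T -` A) = emeasure \<mu> A}"

text \<open>The coarsest topology on the set of regular Borel probability measures for which
  \<open>\<mu> \<mapsto> \<integral> f d\<mu>\<close> is continuous for every continuous real function \<open>f\<close>.\<close>

definition weak_star_topology :: "'a::topological_space measure topology" where
  "weak_star_topology =
     topology_generated_by
       {{\<mu> \<in> prob_measures. (LINT x|\<mu>. f x) \<in> U} | (f :: 'a \<Rightarrow> real) U.
          continuous_on UNIV f \<and> open U}"

text \<open>\<open>return borel y\<close> is the Dirac measure at \<open>y\<close>. For \<open>n = 0\<close> the result is the zero measure,
  which does not affect limits.\<close>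

definition empirical_measure ::
    "('a::topological_space \<Rightarrow> 'a) \<Rightarrow> 'a \<Rightarrow> nat \<Rightarrow> 'a measure" where
  "empirical_measure T x n =
     measure_of UNIV (sets borel)
       (\<lambda>A. ennreal (1 / real n) * (\<Sum>k=1..n. emeasure (return borel ((T ^^ k) x)) A))"

definition basin :: "('a::topological_space \<Rightarrow> 'a) \<Rightarrow> 'a measure \<Rightarrow> 'a set" where
  "basin T \<mu> = {x. limitin weak_star_topology (empirical_measure T x) \<mu> sequentially}"

definition physical_measure ::
    "('a::topological_space \<Rightarrow> 'a) \<Rightarrow> 'a measure \<Rightarrow> 'a measure \<Rightarrow> bool" where
  "physical_measure T m \<mu> \<longleftrightarrow> \<mu> \<in> invariant_measures T \<and> emeasure m (basin T \<mu>) > 0"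

definition generic_points :: "('a::topological_space \<Rightarrow> 'a) \<Rightarrow> 'a set" where
  "generic_points T =
     {x. \<forall>f :: 'a \<Rightarrow> real. continuous_on UNIV f \<longrightarrow>
           convergent (\<lambda>n. 1 / real n * (\<Sum>k=1..n. f ((T ^^ k) x)))}"

text \<open>The average distance of the first \<open>n\<close> orbit points under the best matching. The infimum is
  over the finite nonempty set of permutations of \<open>{1..n}\<close>, hence attained.\<close>

definition matching_dist ::
    "('a::metric_space \<Rightarrow> 'a) \<Rightarrow> nat \<Rightarrow> 'a \<Rightarrow> 'a \<Rightarrow> real" where
  "matching_dist T n x y =
     (INF \<sigma>\<in>{\<sigma>. \<sigma> permutes {1..n}}.
        1 / real n * (\<Sum>k=1..n. dist ((T ^^ k) x) ((T ^^ \<sigma> k) y)))"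

text \<open>Upper and lower limits are taken in the extended reals; on a compact space they are finite,
  since \<^const>\<open>matching_dist\<close> is bounded by the diameter.\<close>

definition F_upper :: "('a::metric_space \<Rightarrow> 'a) \<Rightarrow> 'a \<Rightarrow> 'a \<Rightarrow> ereal" where
  "F_upper T x y = limsup (\<lambda>n. ereal (matching_dist T n x y))"

definition F_lower :: "('a::metric_space \<Rightarrow> 'a) \<Rightarrow> 'a \<Rightarrow> 'a \<Rightarrow> ereal" where
  "F_lower T x y = liminf (\<lambda>n. ereal (matching_dist T n x y))"

definition F_exists :: "('a::metric_space \<Rightarrow> 'a) \<Rightarrow> 'a \<Rightarrow> 'a \<Rightarrow> bool" where
  "F_exists T x y \<longleftrightarrow> F_upper T x y = F_lower T x y"

text \<open>Meaningful only where \<^const>\<open>F_exists\<close> holds.\<close>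

definition F_value :: "('a::metric_space \<Rightarrow> 'a) \<Rightarrow> 'a \<Rightarrow> 'a \<Rightarrow> ereal" where
  "F_value T x y = F_upper T x y"

definition N_F :: "('a::metric_space \<Rightarrow> 'a) \<Rightarrow> ('a \<times> 'a) set" where
  "N_F T = {(x, y). F_exists T x y \<and> F_value T x y = 0}"

definition N_F_lower :: "('a::metric_space \<Rightarrow> 'a) \<Rightarrow> ('a \<times> 'a) set" where
  "N_F_lower T = {(x, y). F_lower T x y = 0}"

end

(* On pairs of generic points, each of F(x,y) = 0 and F_lower(x,y) = 0 means that x and y have the
   same Birkhoff limits for every continuous function. If F_lower(x,y) = 0, uniform continuity makes
   the Birkhoff averages along x and y arbitrarily close infinitely often, and both converge.
   Conversely, if the limits agree, cut the space into finitely many pieces of small diameter whose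
   boundaries carry almost no mass; the two orbits visit each piece with almost the same frequency,
   so a permutation matches most orbit points inside a common piece.

   Hence both sets in the theorem are the equivalence relation "same Birkhoff limits" on generic
   points. Its class of x is the basin of the measure that represents the limit functional at x
   (Riesz), which is invariant; conversely each nonempty basin is a class. By Fubini the relation
   has positive product measure iff some class has positive measure. *)

theory Submission
  imports Defs
begin

subsection \<open>Riesz representation on a compact metric space\<close>

text \<open>\<open>emeasure\<close> is 0 off the sigma-algebra, so a relation or basin that failed
  to be measurable would count as null. Measurability therefore has to be settled before Fubini.
  Genericity and equality of limits quantify over all continuous functions, which is cut down to a
  countable uniformly dense family; basins are then measurable as sections of the relation. Members
  of \<open>prob_measures\<close> are regular by definition, so regularity must be proved for the
  representing measure, to have an invariant measure at all, and for the empirical measures, to read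
  weak-star limits as Birkhoff limits.

  The matching argument makes no use of the representing measure. That a boundary carries almost no
  mass is expressed by two continuous functions that enclose an indicator and have nearly the same
  limit average. Both orbits have the same limits on these two functions, which compares their visit
  frequencies directly.\<close>

lemma ex_bump:
  fixes U :: "'a::metric_space set"
  assumes "open U"
  obtains d :: "'a \<Rightarrow> real" where "continuous_on UNIV d" "\<And>x. 0 \<le> d x" "\<And>x. d x \<le> 1"
    "\<And>x. 0 < d x \<longleftrightarrow> x \<in> U"
\<comment> \<open>\<open>infdist x {}\<close> is 0 by convention, so the distance to the complement
  would vanish on the whole space.\<close>
proof (cases "U = UNIV")
  case True
  then show ?thesis using that[of "\<lambda>_. 1"] by auto
next
  case False
  have cl: "closed (-U)" "-U \<noteq> {}" using assms False by auto
  have "0 < infdist x (-U) \<longleftrightarrow> x \<in> U" for x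
    using in_closed_iff_infdist_zero[OF cl, of x] infdist_nonneg[of x "-U"] by auto
  then show ?thesis
    by (intro that[of "\<lambda>x. min 1 (infdist x (-U))"]) (auto intro!: continuous_intros simp: infdist_nonneg)
qed

text \<open>The laws are demanded for continuous functions only: the intended instance is
  \<open>lim (birkhoff_avg T f x)\<close> at a generic point \<open>x\<close>, and this limit need
  not exist for other \<open>f\<close>.\<close>

locale normalized_positive_functional =
  fixes L :: "('a::metric_space \<Rightarrow> real) \<Rightarrow> real"
  assumes compact_space: "compact (UNIV :: 'a set)"
    and add: "continuous_on UNIV f \<Longrightarrow> continuous_on UNIV g \<Longrightarrow> L (\<lambda>x. f x + g x) = L f + L g"
    and scale: "continuous_on UNIV f \<Longrightarrow> L (\<lambda>x. c * f x) = c * L f"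
    and mono: "continuous_on UNIV f \<Longrightarrow> continuous_on UNIV g \<Longrightarrow> (\<And>x. f x \<le> g x) \<Longrightarrow> L f \<le> L g"
    and one: "L (\<lambda>_. 1) = 1"
begin

lemma const: "L (\<lambda>_. c) = c"
  using scale[of "\<lambda>_. 1" c] one by simp

lemma nonneg: "continuous_on UNIV f \<Longrightarrow> (\<And>x. 0 \<le> f x) \<Longrightarrow> 0 \<le> L f"
  using mono[of "\<lambda>_. 0" f] const[of 0] by simp

lemma sum: "finite I \<Longrightarrow> (\<And>i. i \<in> I \<Longrightarrow> continuous_on UNIV (f i)) \<Longrightarrow> L (\<lambda>x. \<Sum>i\<in>I. f i x) = (\<Sum>i\<in>I. L (f i))"
proof (induction I rule: finite_induct)
  case empty
  then show ?case using const[of 0] by simp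
next
  case (insert i I)
  then show ?case using add[of "f i" "\<lambda>x. \<Sum>i\<in>I. f i x"] by (simp add: continuous_on_sum)
qed

section \<open>The outer measure induced by the functional\<close>

definition below :: "'a set \<Rightarrow> ('a \<Rightarrow> real) set" where
  "below U = {f. continuous_on UNIV f \<and> (\<forall>x. 0 \<le> f x \<and> f x \<le> 1) \<and> (\<forall>x. x \<notin> U \<longrightarrow> f x = 0)}"

text \<open>The usual content of an open set in the Riesz theorem. Test functions only have to
  vanish off \<open>U\<close>, not to have support inside \<open>U\<close>: subtracting a small
  \<open>e\<close> and cutting at 0 confines them to a closed superlevel set within
  \<open>U\<close>.\<close>

definition content :: "'a set \<Rightarrow> ennreal" where
  "content U = (SUP f\<in>below U. ennreal (L f))"

definition outer :: "'a set \<Rightarrow> ennreal" where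
  "outer A = (INF U\<in>{U. open U \<and> A \<subseteq> U}. content U)"

lemma below_le_content: "f \<in> below U \<Longrightarrow> ennreal (L f) \<le> content U"
  unfolding content_def by (rule SUP_upper)

lemma content_mono: "U \<subseteq> V \<Longrightarrow> content U \<le> content V"
  unfolding content_def by (rule SUP_subset_mono) (auto simp: below_def)

lemma content_le_one: "content U \<le> 1"
proof -
  have "L f \<le> 1" if "f \<in> below U" for f
    using mono[of f "\<lambda>_. 1"] that one by (auto simp: below_def)
  then show ?thesis unfolding content_def by (intro SUP_least) (auto simp: ennreal_le_1)
qed

lemma content_UNIV: "content UNIV = 1"
  using below_le_content[of "\<lambda>_. 1" UNIV] content_le_one[of UNIV] one by (simp add: below_def)

lemma content_empty: "content {} = 0"
proof -
  have "below {} = {\<lambda>_. 0}" by (auto simp: below_def)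
  then show ?thesis unfolding content_def using const[of 0] by simp
qed

lemma outer_open: "open U \<Longrightarrow> outer U = content U"
  unfolding outer_def by (intro antisym INF_lower INF_greatest content_mono) auto

lemma outer_mono: "A \<subseteq> B \<Longrightarrow> outer A \<le> outer B"
  unfolding outer_def by (rule INF_superset_mono) auto

lemma outer_le_one: "outer A \<le> 1"
  using outer_mono[of A UNIV] outer_open[of UNIV] content_UNIV by simp

lemma cont_truncate: "continuous_on UNIV f \<Longrightarrow> continuous_on UNIV (\<lambda>x. max 0 (f x - e :: real))"
  by (intro continuous_intros)

lemma closed_superlevel:
  fixes f :: "'a \<Rightarrow> real"
  assumes "continuous_on UNIV f" shows "closed {x. e \<le> f x}"
  using closed_Collect_le[OF continuous_on_const assms] .

text \<open>After \<open>g\<close> is lowered by \<open>e\<close> and cut at 0, it lives on the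
  compact set \<open>{x. e \<le> g x}\<close>, which finitely many \<open>U i\<close> cover. There
  it splits into summands subordinate to these \<open>U i\<close>, and \<open>L\<close> is additive;
  the lowering costs at most \<open>e\<close>.\<close>

lemma content_subadditive:
  fixes U :: "nat \<Rightarrow> 'a set"
  assumes op: "\<And>i. open (U i)"
  shows "content (\<Union>i. U i) \<le> (\<Sum>i. content (U i))"
  unfolding content_def[of "\<Union>i. U i"]
proof (rule SUP_least)
  fix g assume g: "g \<in> below (\<Union>i. U i)"
  then have cg: "continuous_on UNIV g" and g01: "\<And>x. 0 \<le> g x" "\<And>x. g x \<le> 1"
    and g0: "\<And>x. x \<notin> (\<Union>i. U i) \<Longrightarrow> g x = 0" by (auto simp: below_def)
  show "ennreal (L g) \<le> (\<Sum>i. content (U i))"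
  proof (rule ennreal_le_epsilon)
    fix e :: real assume e: "0 < e"
    define K where "K = {x. e \<le> g x}"
    have cK: "compact K"
      using compact_Int_closed[OF compact_space closed_superlevel[OF cg, of e]] by (simp add: K_def)
    have "K \<subseteq> (\<Union>i. U i)" using g0 e by (force simp: K_def)
    then obtain I where I: "finite I" "K \<subseteq> (\<Union>i\<in>I. U i)"
      using compactE_image[OF cK, of UNIV U] op by auto
    have "\<forall>i. \<exists>d::'a\<Rightarrow>real. continuous_on UNIV d \<and> (\<forall>x. 0 \<le> d x) \<and> (\<forall>x. 0 < d x \<longleftrightarrow> x \<in> U i)"
      using ex_bump[OF op] by metis
    then obtain d :: "nat \<Rightarrow> 'a \<Rightarrow> real" where cd: "\<And>i. continuous_on UNIV (d i)"
      and d0: "\<And>i x. 0 \<le> d i x" and dpos: "\<And>i x. 0 < d i x \<longleftrightarrow> x \<in> U i" by metis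
    define h where "h x = (\<Sum>i\<in>I. d i x)" for x
    have ch: "continuous_on UNIV h" unfolding h_def by (intro continuous_on_sum cd)
    have hK: "0 < h x" if "x \<in> K" for x
    proof -
      from that I(2) obtain i where "i \<in> I" "x \<in> U i" by blast
      then show ?thesis unfolding h_def using dpos I(1) d0 by (intro sum_pos2[of I i]) auto
    qed
    obtain \<delta> where \<delta>: "0 < \<delta>" "\<And>x. x \<in> K \<Longrightarrow> \<delta> \<le> h x"
    proof (cases "K = {}")
      case True then show ?thesis using that[of 1] by auto
    next
      case False
      obtain x0 where "x0 \<in> K" "\<forall>y\<in>K. h x0 \<le> h y"
        using continuous_attains_inf[OF cK False continuous_on_subset[OF ch]] by auto
      then show ?thesis using that[of "h x0"] hK by auto
    qed
    \<comment> \<open>Each \<open>i\<close> receives the share \<open>d i / h\<close> of the lowered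
      function. The bound \<open>\<delta>\<close> in the denominator keeps the quotient continuous
      where \<open>h\<close> vanishes; on \<open>K\<close> it changes nothing, and off
      \<open>K\<close> the first factor is 0.\<close>
    define p where "p i x = max 0 (g x - e) * (d i x / max \<delta> (h x))" for i x
    have mpos: "0 < max \<delta> (h x)" for x using \<delta> by auto
    have cp: "continuous_on UNIV (p i)" for i
      unfolding p_def using mpos cd ch cg by (intro continuous_intros) (auto simp: less_imp_neq[symmetric])
    have p0: "0 \<le> p i x" for i x unfolding p_def using d0 mpos[of x] by simp
    have psum: "(\<Sum>i\<in>I. p i x) = max 0 (g x - e)" for x
    proof (cases "x \<in> K")
      case True
      have "(\<Sum>i\<in>I. p i x) = max 0 (g x - e) * (h x / max \<delta> (h x))"
        unfolding p_def h_def by (simp add: sum_distrib_left sum_divide_distrib)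
      moreover have "max \<delta> (h x) = h x" using \<delta> True by auto
      ultimately show ?thesis using hK[OF True] by simp
    next
      case False then show ?thesis by (simp add: p_def K_def)
    qed
    have pb: "p i \<in> below (U i)" if "i \<in> I" for i
    proof -
      have "p i x \<le> (\<Sum>i\<in>I. p i x)" for x
        by (rule member_le_sum) (use that p0 I in auto)
      moreover have "max 0 (g x - e) \<le> 1" for x using g01(2)[of x] e by simp
      ultimately have "p i x \<le> 1" for x by (metis psum order_trans)
      moreover have "p i x = 0" if "x \<notin> U i" for x
        using dpos[of i x] d0[of i x] that by (simp add: p_def)
      ultimately show ?thesis using cp p0 by (auto simp: below_def)
    qed
    have "L g \<le> L (\<lambda>x. max 0 (g x - e) + e)"
      by (intro mono cg continuous_intros) auto
    also have "\<dots> = L (\<lambda>x. \<Sum>i\<in>I. p i x) + e"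
      using add[OF cont_truncate[OF cg], of "\<lambda>_. e" e] const[of e] by (simp add: psum)
    also have "\<dots> = (\<Sum>i\<in>I. L (p i)) + e" using sum[OF I(1)] cp by simp
    finally have "ennreal (L g) \<le> ennreal ((\<Sum>i\<in>I. L (p i)) + e)" by (rule ennreal_leI)
    also have "\<dots> = (\<Sum>i\<in>I. ennreal (L (p i))) + ennreal e"
      using e nonneg[OF cp p0] by (simp add: sum_nonneg)
    also have "\<dots> \<le> (\<Sum>i\<in>I. content (U i)) + ennreal e"
      by (intro add_mono sum_mono below_le_content pb order_refl)
    also have "\<dots> \<le> (\<Sum>i. content (U i)) + ennreal e"
      by (intro add_mono sum_le_suminf I) auto
    finally show "ennreal (L g) \<le> (\<Sum>i. content (U i)) + ennreal e" .
  qed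
qed

lemma outer_approx:
  assumes "0 < e" obtains U where "open U" "A \<subseteq> U" "content U \<le> outer A + ennreal e"
proof -
  have "outer A < outer A + ennreal e"
    using outer_le_one[of A] assms ennreal_add_left_cancel_less[of "outer A" 0 "ennreal e"]
    by (auto simp: top_unique)
  then obtain U where "open U" "A \<subseteq> U" "content U < outer A + ennreal e"
    unfolding outer_def by (subst (asm) INF_less_iff) auto
  then show ?thesis using that[of U] by auto
qed

lemma outer_subadditive: "outer (\<Union>i. A i) \<le> (\<Sum>i::nat. outer (A i))"
proof (rule ennreal_le_epsilon)
  fix e :: real assume e: "0 < e"
  have "\<forall>i. \<exists>U. open U \<and> A i \<subseteq> U \<and> content U \<le> outer (A i) + ennreal (e * (1/2)^Suc i)"
  proof
    fix i
    have "0 < e * (1/2)^Suc i" using e by simp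
    from outer_approx[OF this, of "A i"]
    show "\<exists>U. open U \<and> A i \<subseteq> U \<and> content U \<le> outer (A i) + ennreal (e * (1/2)^Suc i)" by metis
  qed
  then obtain U where U: "\<And>i. open (U i)" "\<And>i. A i \<subseteq> U i"
    "\<And>i. content (U i) \<le> outer (A i) + ennreal (e * (1/2)^Suc i)" by metis
  have "outer (\<Union>i. A i) \<le> outer (\<Union>i. U i)" using U(2) by (intro outer_mono) blast
  also have "\<dots> = content (\<Union>i. U i)" using U(1) by (intro outer_open) auto
  also have "\<dots> \<le> (\<Sum>i. content (U i))" by (rule content_subadditive[OF U(1)])
  also have "\<dots> \<le> (\<Sum>i. outer (A i) + ennreal (e * (1/2)^Suc i))"
    by (intro suminf_le U(3)) auto
  also have "\<dots> = (\<Sum>i. outer (A i)) + (\<Sum>i. ennreal (e * (1/2)^Suc i))"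
    by (rule suminf_add[symmetric]) auto
  also have "(\<Sum>i. ennreal (e * (1/2)^Suc i)) = ennreal e"
    using sums_mult[OF power_half_series, of e] e by (subst suminf_ennreal_eq[of _ e]) auto
  finally show "outer (\<Union>i. A i) \<le> (\<Sum>i. outer (A i)) + ennreal e" .
qed

lemma outer_empty: "outer {} = 0"
  using outer_open[of "{}"] content_empty by simp

lemma outer_subadditive2: "outer (A \<union> B) \<le> outer A + outer B"
  using outer_subadditive[of "\<lambda>i. if i = 0 then A else if i = 1 then B else {}"]
  by (subst (asm) suminf_finite[of "{0,1}"]) (auto simp: outer_empty intro: order_trans[OF outer_mono[of "A \<union> B"], rotated] split: if_splits)

text \<open>A function \<open>g\<close> below \<open>V \<inter> U\<close>, lowered by
  \<open>e\<close> and cut at 0, vanishes off the closed set \<open>K = {x. e \<le> g x}\<close>. So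
  any \<open>h\<close> below the open set \<open>V - K\<close>, which contains \<open>V - U\<close>,
  can be added to it without exceeding 1. Taking suprema over \<open>h\<close> and then over
  \<open>g\<close> gives the inequality.\<close>

lemma content_split:
  assumes U: "open U" and V: "open V"
  shows "content (V \<inter> U) + outer (V - U) \<le> content V"
proof (rule ennreal_le_epsilon)
  fix e :: real assume e: "0 < e"
  have ne: "below W \<noteq> {}" for W by (auto simp: below_def intro!: exI[of _ "\<lambda>_. 0"])
  have "ennreal (L g) + outer (V - U) \<le> content V + ennreal e" if g: "g \<in> below (V \<inter> U)" for g
  proof -
    from g have cg: "continuous_on UNIV g" and g01: "\<And>x. 0 \<le> g x" "\<And>x. g x \<le> 1"
      and g0: "\<And>x. x \<notin> V \<inter> U \<Longrightarrow> g x = 0" by (auto simp: below_def)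
    define K where "K = {x. e \<le> g x}"
    define g' where "g' x = max 0 (g x - e)" for x
    have cg': "continuous_on UNIV g'" unfolding g'_def by (rule cont_truncate[OF cg])
    have opW: "open (V - K)" using V closed_superlevel[OF cg, of e] by (auto simp: K_def)
    have "K \<subseteq> V \<inter> U" using g0 e by (force simp: K_def)
    then have "V - U \<subseteq> V - K" by auto
    then have "outer (V - U) \<le> content (V - K)" using outer_mono outer_open[OF opW] by metis
    then have "ennreal (L g) + outer (V - U) \<le> ennreal (L g) + content (V - K)"
      by (rule add_left_mono)
    also have "\<dots> = (SUP h\<in>below (V - K). ennreal (L g) + ennreal (L h))"
      unfolding content_def[of "V - K"] by (rule ennreal_SUP_add_right[OF ne])
    also have "\<dots> \<le> content V + ennreal e"
    proof (rule SUP_least)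
      fix h assume h: "h \<in> below (V - K)"
      then have ch: "continuous_on UNIV h" by (auto simp: below_def)
      have "g' x + h x \<le> 1 \<and> 0 \<le> g' x + h x \<and> (x \<notin> V \<longrightarrow> g' x + h x = 0)" for x
      proof (cases "x \<in> K")
        case True
        then have "h x = 0" using h by (auto simp: below_def)
        then show ?thesis using g01(1)[of x] g01(2)[of x] g0[of x] e by (auto simp: g'_def)
      next
        case False
        then have "g' x = 0" by (auto simp: g'_def K_def)
        then show ?thesis using h by (auto simp: below_def)
      qed
      then have "(\<lambda>x. g' x + h x) \<in> below V"
        using cg' ch by (auto simp: below_def intro: continuous_on_add)
      then have *: "ennreal (L g' + L h) \<le> content V"
        using below_le_content add[OF cg' ch] by metis
      have "L g \<le> L (\<lambda>x. g' x + e)"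
        unfolding g'_def by (intro mono cg continuous_intros) auto
      also have "\<dots> = L g' + e" using add[OF cg', of "\<lambda>_. e"] const[of e] by simp
      finally have "L g + L h \<le> (L g' + L h) + e" by simp
      moreover have "0 \<le> L g'" "0 \<le> L h" "0 \<le> L g" using nonneg cg' ch cg h g01 by (auto simp: below_def g'_def)
      ultimately have "ennreal (L g) + ennreal (L h) \<le> ennreal (L g' + L h) + ennreal e"
        using e by (simp add: ennreal_leI flip: ennreal_plus)
      also have "\<dots> \<le> content V + ennreal e" by (intro add_mono * order_refl)
      finally show "ennreal (L g) + ennreal (L h) \<le> content V + ennreal e" .
    qed
    finally show ?thesis .
  qed
  then show "content (V \<inter> U) + outer (V - U) \<le> content V + ennreal e"
    unfolding content_def[of "V \<inter> U"] by (subst ennreal_SUP_add_left[symmetric, OF ne]) (auto intro: SUP_least)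
qed


text \<open>An arbitrary test set is enlarged to an open one of almost the same outer measure, and
  \<open>content_split\<close> handles open test sets.\<close>

lemma open_in_lambda_system:
  assumes U: "open U" shows "U \<in> lambda_system UNIV (Pow UNIV) outer"
proof -
  have "outer (U \<inter> A) + outer ((UNIV - U) \<inter> A) \<le> outer A" for A
  proof (rule ennreal_le_epsilon)
    fix e :: real assume "0 < e"
    then obtain V where V: "open V" "A \<subseteq> V" "content V \<le> outer A + ennreal e"
      using outer_approx by metis
    have "outer (U \<inter> A) \<le> content (V \<inter> U)"
      using outer_mono[of "U \<inter> A" "V \<inter> U"] outer_open[of "V \<inter> U"] U V
      by (auto simp: open_Int le_infI2 Int_commute)
    moreover have "outer ((UNIV - U) \<inter> A) \<le> outer (V - U)" using V by (intro outer_mono) auto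
    ultimately have "outer (U \<inter> A) + outer ((UNIV - U) \<inter> A) \<le> content (V \<inter> U) + outer (V - U)"
      by (rule add_mono)
    also have "\<dots> \<le> content V" by (rule content_split[OF U V(1)])
    finally show "outer (U \<inter> A) + outer ((UNIV - U) \<inter> A) \<le> outer A + ennreal e" using V(3) by simp
  qed
  moreover have "outer A \<le> outer (U \<inter> A) + outer ((UNIV - U) \<inter> A)" for A
    using outer_subadditive2[of "U \<inter> A" "(UNIV - U) \<inter> A"] by (simp add: Int_Un_distrib2[symmetric])
  ultimately show ?thesis by (auto simp: lambda_system_def intro: antisym)
qed

text \<open>The Caratheodory sigma-algebra contains the open sets, hence all Borel sets, and passes
  its countable additivity on to them.\<close>

lemma measure_space_outer: "measure_space UNIV (sets borel) outer"
proof -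
  have oms: "outer_measure_space (Pow UNIV) outer"
    unfolding outer_measure_space_def positive_def increasing_def countably_subadditive_def
    using outer_empty outer_mono outer_subadditive by auto
  have ms: "measure_space UNIV (lambda_system UNIV (Pow UNIV) outer) outer"
    by (rule sigma_algebra.caratheodory_lemma[OF sigma_algebra_Pow oms])
  then have "sigma_algebra UNIV (lambda_system UNIV (Pow UNIV) outer)"
    by (simp add: measure_space_def)
  then have "sigma_sets UNIV {S. open S} \<subseteq> lambda_system UNIV (Pow UNIV) outer"
    using open_in_lambda_system by (intro sigma_algebra.sigma_sets_subset) auto
  then have sub: "sets borel \<subseteq> lambda_system UNIV (Pow UNIV) outer"
    by (simp add: borel_def)
  have sa: "sigma_algebra UNIV (sets (borel :: 'a measure))"
    using sets.sigma_algebra_axioms[of "borel :: 'a measure"] by simp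
  have "countably_additive (sets borel) outer"
    unfolding countably_additive_def
  proof (intro allI impI)
    fix A :: "nat \<Rightarrow> 'a set"
    assume "range A \<subseteq> sets borel" "disjoint_family A" "(\<Union>i. A i) \<in> sets borel"
    with sub have "range A \<subseteq> lambda_system UNIV (Pow UNIV) outer"
      "(\<Union>i. A i) \<in> lambda_system UNIV (Pow UNIV) outer" by blast+
    with \<open>disjoint_family A\<close> ms show "(\<Sum>i. outer (A i)) = outer (\<Union>i. A i)"
      by (simp add: measure_space_def countably_additive_def)
  qed
  then show ?thesis using sa outer_empty by (simp add: measure_space_def positive_def)
qed

section \<open>The representing measure and its integrals\<close>

definition representing_measure :: "'a measure" where
  "representing_measure = measure_of UNIV (sets borel) outer"

lemma sets_representing [simp, measurable_cong]: "sets representing_measure = sets borel"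
  using sets_measure_of[of "sets borel" "UNIV :: 'a set" outer] sets.sigma_sets_eq[of "borel :: 'a measure"]
  by (simp add: representing_measure_def)

lemma space_representing [simp]: "space representing_measure = UNIV"
  by (simp add: representing_measure_def space_measure_of)

lemma emeasure_representing: "A \<in> sets borel \<Longrightarrow> emeasure representing_measure A = outer A"
  using measure_space_outer
  by (intro emeasure_measure_of[OF representing_measure_def]) (auto simp: measure_space_def)

lemma prob_space_representing: "prob_space representing_measure"
  by (intro prob_spaceI) (simp add: emeasure_representing outer_open content_UNIV)

text \<open>The bridge between \<open>L\<close> and \<open>content\<close>: the ramp that climbs
  from 0 to 1 while \<open>f\<close> runs from \<open>b\<close> to \<open>b + a\<close> dominates
  every test function for the upper superlevel set, and is itself a test function for the lower
  one.\<close>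

lemma content_between:
  assumes f: "continuous_on UNIV f" and a: "0 < (a::real)"
  shows "content {x. b + a < f x} \<le> ennreal (L (\<lambda>x. min 1 (max 0 ((f x - b) / a))))"
    and "ennreal (L (\<lambda>x. min 1 (max 0 ((f x - b) / a)))) \<le> content {x. b < f x}"
proof -
  let ?g = "\<lambda>x. min 1 (max 0 ((f x - b) / a))"
  have cg: "continuous_on UNIV ?g" using a by (intro continuous_intros f) auto
  show "content {x. b + a < f x} \<le> ennreal (L ?g)"
    unfolding content_def
  proof (intro SUP_least ennreal_leI mono cg)
    fix h x assume h: "h \<in> below {x. b + a < f x}"
    show "h x \<le> ?g x" 
    proof (cases "b + a < f x")
      case True
      then have "1 \<le> (f x - b) / a" using a by (simp add: field_simps)
      then show ?thesis using h by (auto simp: below_def)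
    next
      case False
      then show ?thesis using h by (auto simp: below_def)
    qed
  qed (auto simp: below_def)
  show "ennreal (L ?g) \<le> content {x. b < f x}"
    using cg a by (intro below_le_content) (auto simp: below_def divide_nonpos_pos)
qed

lemma integrable_representing:
  fixes f :: "'a \<Rightarrow> real"
  assumes "continuous_on UNIV f" shows "integrable representing_measure f"
proof -
  interpret prob_space representing_measure by (rule prob_space_representing)
  obtain B where "\<And>x. norm (f x) \<le> B"
    using compact_imp_bounded[OF compact_continuous_image[OF assms compact_space]]
    by (auto simp: bounded_iff)
  then show ?thesis
    by (intro integrable_const_bound[of _ B])
      (auto simp: measurable_cong_sets[OF sets_representing refl] borel_measurable_continuous_onI assms)
qed

text \<open>A layer-cake argument. \<open>f\<close> is cut into \<open>N\<close> ramps of height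
  \<open>a\<close>; for the ramp at level \<open>i\<close> both the integral and \<open>L\<close>
  lie between \<open>p (Suc i)\<close> and \<open>p i\<close>. The errors telescope to at most
  \<open>a\<close>, which tends to 0 as \<open>N\<close> grows.\<close>

theorem integral_representing:
  assumes f: "continuous_on UNIV f"
  shows "(LINT x|representing_measure. f x) = L f"
proof -
  interpret prob_space representing_measure by (rule prob_space_representing)
  obtain B0 where B0: "\<And>x. norm (f x) \<le> B0"
    using compact_imp_bounded[OF compact_continuous_image[OF f compact_space]]
    by (auto simp: bounded_iff)
  define B where "B = max 1 B0"
  have B: "B > 0" "\<And>x. \<bar>f x\<bar> \<le> B" using B0 by (auto simp: B_def intro: le_max_iff_disj[THEN iffD2])
  have "\<bar>(LINT x|representing_measure. f x) - L f\<bar> \<le> 2 * B / N" if N: "N > 0" for N :: nat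
  proof -
    \<comment> \<open>With this height the levels run from \<open>b 0 = - B\<close> to
      \<open>b N = B\<close> and cover the range of \<open>f\<close>.\<close>
    define a where "a = 2 * B / N"
    have a: "a > 0" using B N by (simp add: a_def)
    define b where "b i = - B + a * real i" for i :: nat
    define g where "g i x = min 1 (max 0 ((f x - b i) / a))" for i x
    define p where "p i = measure representing_measure {x. b i < f x}" for i
    have op: "open {x. b i < f x}" for i by (rule open_Collect_less[OF continuous_on_const f])
    have cont_p: "content {x. b i < f x} = ennreal (p i)" for i
      using emeasure_representing[of "{x. b i < f x}"] outer_open[OF op] op
      by (simp add: p_def emeasure_eq_measure)
    have bS: "b (Suc i) = b i + a" for i by (simp add: b_def algebra_simps)
    have cg: "continuous_on UNIV (g i)" for i unfolding g_def using a by (intro continuous_intros f) auto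
    have p0: "0 \<le> p i" "p i \<le> 1" for i by (auto simp: p_def)
    have g0: "0 \<le> g i x" "g i x \<le> 1" for i x by (auto simp: g_def)
    have g_fun: "g i = (\<lambda>x. min 1 (max 0 ((f x - b i) / a)))" for i by (simp add: g_def fun_eq_iff)
    have Lg: "p (Suc i) \<le> L (g i)" "L (g i) \<le> p i" for i
    proof -
      have "ennreal (p (Suc i)) \<le> ennreal (L (g i))"
        using content_between(1)[OF f a, of "b i"] cont_p[of "Suc i"] by (simp add: bS g_fun)
      then show "p (Suc i) \<le> L (g i)" using nonneg[OF cg g0(1)] by (simp add: ennreal_le_iff)
      have "ennreal (L (g i)) \<le> ennreal (p i)"
        using content_between(2)[OF f a, of "b i"] cont_p[of "i"] by (simp add: g_fun)
      then show "L (g i) \<le> p i" using p0 by (simp add: ennreal_le_iff)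
    qed
    have ms: "{x. b i < f x} \<in> sets representing_measure" for i using op by simp
    have Ig: "p (Suc i) \<le> (LINT x|representing_measure. g i x)" "(LINT x|representing_measure. g i x) \<le> p i" for i
    proof -
      have "p (Suc i) = (LINT x|representing_measure. indicator {x. b (Suc i) < f x} x)"
        by (simp add: p_def)
      also have "\<dots> \<le> (LINT x|representing_measure. g i x)"
      proof (rule integral_mono)
        show "integrable representing_measure (\<lambda>x. indicator {x. b (Suc i) < f x} x :: real)"
          using ms by (intro integrable_real_indicator) (auto simp: emeasure_eq_measure)
        show "integrable representing_measure (g i)" by (rule integrable_representing[OF cg])
        fix x
        have "1 \<le> (f x - b i) / a" if "b (Suc i) < f x" using that a by (simp add: field_simps bS)
        then show "indicator {x. b (Suc i) < f x} x \<le> g i x"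
          by (auto simp: g_def split: split_indicator)
      qed
      finally show "p (Suc i) \<le> (LINT x|representing_measure. g i x)" .
      have "(LINT x|representing_measure. g i x) \<le> (LINT x|representing_measure. indicator {x. b i < f x} x)"
      proof (rule integral_mono)
        show "integrable representing_measure (\<lambda>x. indicator {x. b i < f x} x :: real)"
          using ms by (intro integrable_real_indicator) (auto simp: emeasure_eq_measure)
        show "integrable representing_measure (g i)" by (rule integrable_representing[OF cg])
        fix x
        show "g i x \<le> indicator {x. b i < f x} x"
          using a by (auto simp: g_def divide_nonpos_pos split: split_indicator)
      qed
      also have "\<dots> = p i" by (simp add: p_def)
      finally show "(LINT x|representing_measure. g i x) \<le> p i" .
    qed
    \<comment> \<open>Measured in units of \<open>a\<close>, the first \<open>n\<close> ramps
      together fill the part of \<open>f x + B\<close> between 0 and \<open>n\<close>.\<close>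
    have clamp: "(\<Sum>i<n. g i x) = min (real n) (max 0 ((f x + B) / a))" for n x
    proof (induction n)
      case (Suc n)
      have "(f x - b n) / a = (f x + B) / a - real n" using a by (simp add: b_def field_simps)
      then show ?case using Suc by (simp add: g_def)
    qed simp
    have fsum: "f x = - B + a * (\<Sum>i<N. g i x)" for x
    proof -
      have "0 \<le> (f x + B) / a" using B(2)[of x] a by simp
      moreover have "(f x + B) / a \<le> N" using B(2)[of x] a N by (simp add: a_def field_simps abs_le_iff)
      ultimately show ?thesis using a by (simp add: clamp)
    qed
    have f_eq: "f = (\<lambda>x. - B + a * (\<Sum>i<N. g i x))" using fsum by auto
    have L1: "L f = - B + a * (\<Sum>i<N. L (g i))"
    proof -
      have c: "continuous_on UNIV (\<lambda>x. \<Sum>i<N. g i x)" by (intro continuous_on_sum cg)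
      have "L f = L (\<lambda>x. - B + a * (\<Sum>i<N. g i x))" by (rule arg_cong[OF f_eq])
      also have "\<dots> = - B + a * L (\<lambda>x. \<Sum>i<N. g i x)"
        using add[of "\<lambda>_. -B" "\<lambda>x. a * (\<Sum>i<N. g i x)"] const[of "-B"] scale[OF c, of a] c
        by (simp add: continuous_on_mult_left)
      finally show ?thesis using sum[of "{..<N}" g] cg by simp
    qed
    have I1: "(LINT x|representing_measure. f x) = - B + a * (\<Sum>i<N. (LINT x|representing_measure. g i x))"
      by (subst f_eq) (simp add: integrable_representing[OF cg] prob_space[simplified])
    have "\<bar>(LINT x|representing_measure. f x) - L f\<bar> = a * \<bar>\<Sum>i<N. (LINT x|representing_measure. g i x) - L (g i)\<bar>"
      using a unfolding L1 I1 by (simp add: sum_subtractf abs_mult flip: right_diff_distrib)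
    also have "\<dots> \<le> a * (\<Sum>i<N. p i - p (Suc i))"
    proof -
      have "\<bar>(LINT x|representing_measure. g i x) - L (g i)\<bar> \<le> p i - p (Suc i)" for i
        using Lg[of i] Ig[of i] by linarith
      then show ?thesis using a by (intro mult_left_mono order_trans[OF sum_abs] sum_mono) auto
    qed
    also have "(\<Sum>i<N. p i - p (Suc i)) = p 0 - p N" by (rule sum_lessThan_telescope')
    also have "a * (p 0 - p N) \<le> a * 1" using a p0[of 0] p0[of N] by (intro mult_left_mono) auto
    finally show ?thesis by (simp add: a_def)
  qed
  note bound = this
  have "(\<lambda>N. 2 * B / real N) \<longlonglongrightarrow> 0" by (rule lim_const_over_n)
  then have "\<bar>(LINT x|representing_measure. f x) - L f\<bar> \<le> 0"
    by (rule tendsto_lowerbound) (use bound in \<open>auto intro!: eventually_sequentiallyI[of 1]\<close>)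
  then show ?thesis by simp
qed

end

subsection \<open>Weak-star convergence of empirical measures\<close>

text \<open>Outer regularity of the complement gives inner regularity: an open set tightly around
  \<open>- A\<close> has a closed complement inside \<open>A\<close>, which is compact because the
  space is.\<close>

lemma regular_borel_measureI:
  fixes M :: "'a::metric_space measure"
  assumes compact: "compact (UNIV :: 'a set)" and "finite_measure M" and sets: "sets M = sets borel"
    and outer: "\<And>A. A \<in> sets borel \<Longrightarrow> (INF U\<in>{U. A \<subseteq> U \<and> open U}. emeasure M U) \<le> emeasure M A"
  shows "regular_borel_measure M"
  unfolding regular_borel_measure_def
proof (intro conjI ballI)
  interpret finite_measure M by fact
  have space: "space M = UNIV" using sets_eq_imp_space_eq[OF sets] by simp
  show "sets M = sets borel" by fact
  fix A :: "'a set" assume A: "A \<in> sets borel"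
  show "emeasure M A = (INF U\<in>{U. A \<subseteq> U \<and> open U}. emeasure M U)"
    using A by (intro antisym outer INF_greatest emeasure_mono) (auto simp: sets)
  show "emeasure M A = (SUP K\<in>{K. K \<subseteq> A \<and> compact K}. emeasure M K)"
  proof (rule antisym)
    show "(SUP K\<in>{K. K \<subseteq> A \<and> compact K}. emeasure M K) \<le> emeasure M A"
      using A by (intro SUP_least emeasure_mono) (auto simp: sets)
    show "emeasure M A \<le> (SUP K\<in>{K. K \<subseteq> A \<and> compact K}. emeasure M K)"
    proof (rule ennreal_le_epsilon)
      fix e :: real assume e: "0 < e"
      have mA: "- A \<in> sets borel" using A by (metis borel_comp)
      have "(INF U\<in>{U. - A \<subseteq> U \<and> open U}. emeasure M U) < ennreal (measure M (-A) + e)"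
        using e outer[OF mA] by (intro le_less_trans[OF outer[OF mA]]) (simp add: emeasure_eq_measure ennreal_less_iff)
      then obtain U where U: "- A \<subseteq> U" "open U" "emeasure M U < ennreal (measure M (-A) + e)"
        by (auto simp: INF_less_iff)
      then have "measure M U < measure M (-A) + e"
        by (simp add: emeasure_eq_measure ennreal_less_iff)
      moreover have "measure M (- A) = measure M UNIV - measure M A"
        using finite_measure_compl[of A] A sets by (simp add: space Compl_eq_Diff_UNIV)
      moreover have "measure M (- U) = measure M UNIV - measure M U"
        using finite_measure_compl[of U] U sets by (simp add: space Compl_eq_Diff_UNIV)
      ultimately have "measure M A \<le> measure M (-U) + e" by linarith
      then have "emeasure M A \<le> emeasure M (-U) + ennreal e"
        using e by (simp add: emeasure_eq_measure ennreal_leI flip: ennreal_plus)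
      also have "emeasure M (-U) \<le> (SUP K\<in>{K. K \<subseteq> A \<and> compact K}. emeasure M K)"
        using U compact_Int_closed[OF compact, of "-U"] by (intro SUP_upper) auto
      finally show "emeasure M A \<le> (SUP K\<in>{K. K \<subseteq> A \<and> compact K}. emeasure M K) + ennreal e"
        by (simp add: add_right_mono)
    qed
  qed
qed

text \<open>Outer regularity is built into \<open>outer\<close>, an infimum of
  \<open>content\<close> over open sets, where the two agree.\<close>

lemma (in normalized_positive_functional) representing_measure_in_prob_measures:
  "representing_measure \<in> prob_measures"
proof -
  interpret prob_space representing_measure by (rule prob_space_representing)
  have "(INF U\<in>{U. A \<subseteq> U \<and> open U}. emeasure representing_measure U) \<le> emeasure representing_measure A"
    if "A \<in> sets borel" for A
    unfolding emeasure_representing[OF that] outer_def[of A]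
    by (rule INF_mono) (auto simp: emeasure_representing outer_open)
  then show ?thesis
    using regular_borel_measureI[OF compact_space finite_measure_axioms] prob_space_axioms
    by (simp add: prob_measures_def)
qed

text \<open>For a bump \<open>d\<close> that is positive exactly on the open set \<open>U\<close>,
  the functions \<open>min 1 (n * d)\<close> converge to the indicator of \<open>U\<close>. Hence
  the measures agree on open sets, an intersection-stable generator of the Borel sets.\<close>

lemma prob_measure_eqI:
  fixes M N :: "'a::metric_space measure"
  assumes M: "prob_space M" "sets M = sets borel" and N: "prob_space N" "sets N = sets borel"
    and eq: "\<And>f::'a \<Rightarrow> real. continuous_on UNIV f \<Longrightarrow> (LINT x|M. f x) = (LINT x|N. f x)"
  shows "M = N"
proof -
  have lim: "(\<lambda>n. LINT x|K. min 1 (real n * d x)) \<longlonglongrightarrow> measure K U"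
    if K: "prob_space K" "sets K = sets borel" and cd: "continuous_on UNIV d" and U: "open U"
      and d0: "\<And>x. 0 \<le> d x" and d1: "\<And>x. 0 < d x \<longleftrightarrow> x \<in> U"
    for K :: "'a measure" and d :: "'a \<Rightarrow> real" and U
  proof -
    interpret prob_space K by fact
    have "(\<lambda>n. LINT x|K. min 1 (real n * d x)) \<longlonglongrightarrow> (LINT x|K. indicator U x)"
    proof (rule integral_dominated_convergence)
      show "indicator U \<in> borel_measurable K"
        using U K by (intro borel_measurable_indicator) auto
      show "(\<lambda>x. min 1 (real n * d x)) \<in> borel_measurable K" for n
        unfolding measurable_cong_sets[OF K(2) refl]
        by (intro borel_measurable_continuous_onI continuous_intros cd)
      show "integrable K (\<lambda>_. 1::real)" by simp
      have "(\<lambda>n. min 1 (real n * d x)) \<longlonglongrightarrow> indicator U x" for x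
      proof (cases "x \<in> U")
        case True
        then have "0 < d x" using d1 by auto
        then obtain n0 where n0: "1 < real n0 * d x" using ex_less_of_nat_mult by blast
        have "eventually (\<lambda>n. min 1 (real n * d x) = 1) sequentially"
        proof (rule eventually_sequentiallyI[of n0])
          fix n assume "n0 \<le> n"
          then have "real n0 * d x \<le> real n * d x" using d0[of x] by (intro mult_right_mono) auto
          then show "min 1 (real n * d x) = 1" using n0 by simp
        qed
        then show ?thesis using True by (simp add: tendsto_eventually)
      next
        case False
        then have "d x = 0" using d0[of x] d1[of x] by auto
        then show ?thesis using False by simp
      qed
      then show "AE x in K. (\<lambda>n. min 1 (real n * d x)) \<longlonglongrightarrow> indicator U x" by simp
      show "AE x in K. norm (min 1 (real n * d x)) \<le> 1" for n using d0 by (intro AE_I2) auto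
    qed
    then show ?thesis using U K by simp
  qed
  have opens: "emeasure M U = emeasure N U" if U: "open U" for U
  proof -
    obtain d :: "'a \<Rightarrow> real" where d: "continuous_on UNIV d" "\<And>x. 0 \<le> d x" "\<And>x. 0 < d x \<longleftrightarrow> x \<in> U"
      using ex_bump[OF U] by metis
    have "(LINT x|M. min 1 (real n * d x)) = (LINT x|N. min 1 (real n * d x))" for n
      by (intro eq continuous_intros d)
    then have "measure M U = measure N U"
      using LIMSEQ_unique[OF lim[OF M d(1) U d(2,3)]] lim[OF N d(1) U d(2,3)] by simp
    then show ?thesis
      using M(1) N(1) by (simp add: finite_measure.emeasure_eq_measure prob_space_def)
  qed
  show ?thesis
  proof (rule measure_eqI_generator_eq[where E = "{S. open S}" and \<Omega> = UNIV and A = "\<lambda>_. UNIV"])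
    show "emeasure M UNIV \<noteq> \<infinity>"
      using M(1) by (simp add: finite_measure.emeasure_eq_measure prob_space_def)
  qed (auto simp: Int_stable_def opens M N borel_def)
qed

section \<open>Empirical measures and Birkhoff averages\<close>

definition birkhoff_avg :: "('a \<Rightarrow> 'a) \<Rightarrow> ('a \<Rightarrow> real) \<Rightarrow> 'a \<Rightarrow> nat \<Rightarrow> real" where
  "birkhoff_avg T f x n = 1 / real n * (\<Sum>k=1..n. f ((T ^^ k) x))"

text \<open>As the image of the uniform measure on the times \<open>1..n\<close>, the empirical
  measure is seen to be a measure, and its integrals become finite averages.\<close>

lemma empirical_measure_eq_distr:
  assumes n: "0 < n"
  shows "empirical_measure T x n = distr (uniform_count_measure {1..n}) borel (\<lambda>k. (T ^^ k) x)"
    (is "_ = ?D")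
proof -
  have "emeasure ?D A = ennreal (1 / real n) * (\<Sum>k=1..n. emeasure (return borel ((T ^^ k) x)) A)"
    if A: "A \<in> sets borel" for A
  proof -
    have "emeasure ?D A = emeasure (uniform_count_measure {1..n}) {k\<in>{1..n}. (T ^^ k) x \<in> A}"
      using A by (subst emeasure_distr) (auto simp: space_uniform_count_measure sets_uniform_count_measure
          intro!: arg_cong2[where f = emeasure])
    also have "\<dots> = ennreal (real (card {k\<in>{1..n}. (T ^^ k) x \<in> A}) / real n)"
      by (subst emeasure_uniform_count_measure) auto
    also have "\<dots> = ennreal (1 / real n) * ennreal (real (card {k\<in>{1..n}. (T ^^ k) x \<in> A}))"
      by (subst ennreal_mult[symmetric]) auto
    also have "ennreal (real (card {k\<in>{1..n}. (T ^^ k) x \<in> A})) = (\<Sum>k=1..n. indicator A ((T ^^ k) x))"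
      by (simp add: indicator_def ennreal_of_nat_eq_real_of_nat[symmetric] sum.If_cases Int_def)
    also have "\<dots> = (\<Sum>k=1..n. emeasure (return borel ((T ^^ k) x)) A)"
      using A by simp
    finally show ?thesis .
  qed
  then have "empirical_measure T x n = measure_of UNIV (sets borel) (emeasure ?D)"
    unfolding empirical_measure_def
    by (intro measure_of_eq) (auto simp: sets.sigma_sets_eq[of borel, simplified])
  also have "\<dots> = ?D" using measure_of_of_measure[of ?D] by simp
  finally show ?thesis .
qed

lemma empirical_measure_in_prob_measures:
  fixes T :: "'a::metric_space \<Rightarrow> 'a"
  assumes "compact (UNIV :: 'a set)" and n: "0 < n"
  shows "empirical_measure T x n \<in> prob_measures"
proof -
  let ?u = "uniform_count_measure {1..n}"
  let ?D = "distr ?u (borel :: 'a measure) (\<lambda>k. (T ^^ k) x)"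
  have meas: "(\<lambda>k. (T ^^ k) x) \<in> measurable ?u borel"
    by (auto simp: measurable_def space_uniform_count_measure sets_uniform_count_measure)
  interpret u: prob_space ?u using n by (intro prob_space_uniform_count_measure) auto
  interpret D: prob_space ?D by (rule u.prob_space_distr[OF meas])
  have "(INF U\<in>{U. A \<subseteq> U \<and> open U}. emeasure ?D U) \<le> emeasure ?D A" if A: "A \<in> sets borel" for A
  proof -
    \<comment> \<open>The orbit points that miss \<open>A\<close> form a finite, hence closed, set.
      Its complement is an open set around \<open>A\<close> of the same mass, so the infimum is
      attained.\<close>
    define P where "P = (\<lambda>k. (T ^^ k) x) ` {1..n} - A"
    have "finite P" by (simp add: P_def)
    then have P: "open (- P)" using finite_imp_closed by blast
    have "(INF U\<in>{U. A \<subseteq> U \<and> open U}. emeasure ?D U) \<le> emeasure ?D (- P)"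
      using P by (intro INF_lower) (auto simp: P_def)
    also have "\<dots> = emeasure ?D A"
      using A P meas by (simp add: emeasure_distr)
        (auto simp: space_uniform_count_measure P_def intro!: arg_cong2[where f = emeasure])
    finally show ?thesis .
  qed
  then have "regular_borel_measure ?D"
    by (intro regular_borel_measureI assms D.finite_measure_axioms) auto
  then show ?thesis
    using D.prob_space_axioms by (simp add: prob_measures_def empirical_measure_eq_distr[OF n])
qed

lemma integral_empirical_measure:
  assumes n: "0 < n" and f: "continuous_on UNIV f"
  shows "(LINT y|empirical_measure T x n. f y) = birkhoff_avg T f x n"
proof -
  let ?u = "uniform_count_measure {1..n}"
  have meas: "(\<lambda>k. (T ^^ k) x) \<in> measurable ?u borel"
    by (auto simp: measurable_def space_uniform_count_measure sets_uniform_count_measure)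
  have "(LINT y|empirical_measure T x n. f y) = (LINT k|?u. f ((T ^^ k) x))"
    unfolding empirical_measure_eq_distr[OF n]
    by (rule integral_distr[OF meas borel_measurable_continuous_onI[OF f]])
  also have "\<dots> = birkhoff_avg T f x n"
    unfolding uniform_count_measure_def birkhoff_avg_def
    by (subst lebesgue_integral_point_measure_finite) (auto simp: sum_distrib_left sum_divide_distrib)
  finally show ?thesis .
qed

text \<open>Convergence may be tested on a subbasis, since being eventually inside survives finite
  intersections and arbitrary unions. The clause \<open>l \<in> \<Union> S\<close> places
  \<open>l\<close> in the underlying space of the topology.\<close>

lemma limitin_topology_generated_by:
  "limitin (topology_generated_by S) f l F \<longleftrightarrow>
    l \<in> \<Union> S \<and> (\<forall>U\<in>S. l \<in> U \<longrightarrow> eventually (\<lambda>x. f x \<in> U) F)"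
proof (intro iffI conjI ballI impI)
  assume *: "l \<in> \<Union> S \<and> (\<forall>U\<in>S. l \<in> U \<longrightarrow> eventually (\<lambda>x. f x \<in> U) F)"
  have "l \<in> U \<longrightarrow> eventually (\<lambda>x. f x \<in> U) F" if "generate_topology_on S U" for U
    using that
  proof induction
    case (Int a b)
    then show ?case by (auto intro: eventually_conj)
  next
    case (UN K)
    show ?case
    proof
      assume "l \<in> \<Union> K"
      then obtain X where "X \<in> K" "l \<in> X" by blast
      with UN have "eventually (\<lambda>x. f x \<in> X) F" by blast
      then show "eventually (\<lambda>x. f x \<in> \<Union> K) F"
        using \<open>X \<in> K\<close> by (auto elim: eventually_mono)
    qed
  qed (use * in auto)
  then show "limitin (topology_generated_by S) f l F"
    using * by (auto simp: limitin_def openin_topology_generated_by_iff)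
qed (auto simp: limitin_def topology_generated_by_Basis)

lemma limitin_weak_star_topology:
  fixes M :: "'b \<Rightarrow> 'a::topological_space measure"
  shows "limitin weak_star_topology M \<mu> F \<longleftrightarrow>
    \<mu> \<in> prob_measures \<and> eventually (\<lambda>i. M i \<in> prob_measures) F \<and>
    (\<forall>f :: 'a \<Rightarrow> real. continuous_on UNIV f \<longrightarrow> ((\<lambda>i. LINT x|M i. f x) \<longlongrightarrow> (LINT x|\<mu>. f x)) F)"
    (is "?l \<longleftrightarrow> ?r")
proof
  let ?S = "{{\<mu> \<in> prob_measures. (LINT x|\<mu>. f x) \<in> U} | (f :: 'a \<Rightarrow> real) U.
          continuous_on UNIV f \<and> open U}"
  assume ?l
  then have mu: "\<mu> \<in> prob_measures"
    and ev: "\<And>V. V \<in> ?S \<Longrightarrow> \<mu> \<in> V \<Longrightarrow> eventually (\<lambda>i. M i \<in> V) F"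
    unfolding weak_star_topology_def limitin_topology_generated_by by auto
  have *: "eventually (\<lambda>i. M i \<in> prob_measures \<and> (LINT x|M i. f x) \<in> U) F"
    if "continuous_on UNIV f" "open U" "(LINT x|\<mu>. f x) \<in> U" for f :: "'a \<Rightarrow> real" and U
    using ev[of "{\<mu> \<in> prob_measures. (LINT x|\<mu>. f x) \<in> U}"] that mu by auto
  show ?r
    using mu *[of "\<lambda>_. 0" UNIV]
    by (auto simp: tendsto_def intro: eventually_mono[OF *])
next
  assume r: ?r
  \<comment> \<open>The constant function 0 with \<open>UNIV\<close> exhibits
    \<open>prob_measures\<close> itself as a subbasic set, so \<open>\<mu>\<close> lies in the space
    of the topology.\<close>
  have "prob_measures = {\<mu> \<in> prob_measures. (LINT x|\<mu>. (\<lambda>_::'a. 0::real) x) \<in> UNIV}" by auto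
  with r have "\<mu> \<in> \<Union> {{\<mu> \<in> prob_measures. (LINT x|\<mu>. f x) \<in> U} | (f :: 'a \<Rightarrow> real) U.
          continuous_on UNIV f \<and> open U}"
    by (intro UnionI[of prob_measures]) (auto intro!: exI[of _ "\<lambda>_. 0"] exI[of _ UNIV])
  then show ?l
    using r unfolding weak_star_topology_def limitin_topology_generated_by
    by (auto simp: tendsto_def intro!: eventually_conj)
qed

lemma basin_iff:
  fixes T :: "'a::metric_space \<Rightarrow> 'a"
  assumes "compact (UNIV :: 'a set)"
  shows "x \<in> basin T \<mu> \<longleftrightarrow> \<mu> \<in> prob_measures \<and>
    (\<forall>f. continuous_on UNIV f \<longrightarrow> birkhoff_avg T f x \<longlonglongrightarrow> (LINT y|\<mu>. f y))"
proof -
  have "eventually (\<lambda>n. empirical_measure T x n \<in> prob_measures) sequentially"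
    using empirical_measure_in_prob_measures[OF assms] by (auto intro: eventually_sequentiallyI[of 1])
  moreover have "((\<lambda>n. LINT y|empirical_measure T x n. f y) \<longlonglongrightarrow> l) \<longleftrightarrow> birkhoff_avg T f x \<longlonglongrightarrow> l"
    if "continuous_on UNIV f" for f l
    by (intro tendsto_cong eventually_sequentiallyI[of 1] integral_empirical_measure that) auto
  ultimately show ?thesis by (simp add: basin_def limitin_weak_star_topology)
qed

lemma generic_points_iff:
  "x \<in> generic_points T \<longleftrightarrow> (\<forall>f. continuous_on UNIV f \<longrightarrow> convergent (birkhoff_avg T f x))"
  by (simp add: generic_points_def birkhoff_avg_def[abs_def])

lemma birkhoff_avg_const: "0 < n \<Longrightarrow> birkhoff_avg T (\<lambda>_. c) x n = c"
  by (simp add: birkhoff_avg_def)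

lemma birkhoff_avg_add: "birkhoff_avg T (\<lambda>y. f y + g y) x n = birkhoff_avg T f x n + birkhoff_avg T g x n"
  by (simp add: birkhoff_avg_def sum.distrib algebra_simps add_divide_distrib)

lemma birkhoff_avg_diff: "birkhoff_avg T (\<lambda>y. f y - g y) x n = birkhoff_avg T f x n - birkhoff_avg T g x n"
  by (simp add: birkhoff_avg_def sum_subtractf algebra_simps diff_divide_distrib)

lemma birkhoff_avg_cmult: "birkhoff_avg T (\<lambda>y. c * f y) x n = c * birkhoff_avg T f x n"
  by (simp add: birkhoff_avg_def sum_distrib_left[symmetric])

lemma birkhoff_avg_mono: "(\<And>y. f y \<le> g y) \<Longrightarrow> birkhoff_avg T f x n \<le> birkhoff_avg T g x n"
  by (simp add: birkhoff_avg_def sum_mono divide_right_mono)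

lemma abs_birkhoff_avg_le:
  assumes "\<And>y. \<bar>f y\<bar> \<le> c" shows "\<bar>birkhoff_avg T f x n\<bar> \<le> c"
proof (cases "n = 0")
  \<comment> \<open>Division by zero makes the average 0 here, and \<open>c\<close> is nonnegative
    because it bounds an absolute value.\<close>
  case True
  then show ?thesis using assms[of undefined] by (simp add: birkhoff_avg_def)
next
  case False
  have "birkhoff_avg T f x n \<le> birkhoff_avg T (\<lambda>_. c) x n"
    using assms by (intro birkhoff_avg_mono) (simp add: abs_le_iff)
  moreover have "birkhoff_avg T (\<lambda>_. - c) x n \<le> birkhoff_avg T f x n"
    using assms by (intro birkhoff_avg_mono) (simp add: abs_le_iff minus_le_iff)
  ultimately show ?thesis using False by (simp add: birkhoff_avg_const abs_le_iff)
qed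

lemma birkhoff_limit_functional:
  fixes T :: "'a::metric_space \<Rightarrow> 'a"
  assumes c: "compact (UNIV :: 'a set)" and x: "x \<in> generic_points T"
  shows "normalized_positive_functional (\<lambda>f. lim (birkhoff_avg T f x))"
proof -
  have lim: "birkhoff_avg T f x \<longlonglongrightarrow> lim (birkhoff_avg T f x)" if "continuous_on UNIV f" for f
    using x that by (simp add: generic_points_iff convergent_LIMSEQ_iff)
  show ?thesis
  proof
    fix f g :: "'a \<Rightarrow> real" and c :: real
    assume f: "continuous_on UNIV f"
    show "lim (birkhoff_avg T (\<lambda>x. c * f x) x) = c * lim (birkhoff_avg T f x)"
      using tendsto_mult_left[OF lim[OF f], of c] by (intro limI) (simp add: birkhoff_avg_cmult[abs_def])
    assume g: "continuous_on UNIV g"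
    show "lim (birkhoff_avg T (\<lambda>x. f x + g x) x) = lim (birkhoff_avg T f x) + lim (birkhoff_avg T g x)"
      using tendsto_add[OF lim[OF f] lim[OF g]] by (intro limI) (simp add: birkhoff_avg_add[abs_def])
    assume "\<And>x. f x \<le> g x"
    then show "lim (birkhoff_avg T f x) \<le> lim (birkhoff_avg T g x)"
      by (intro LIMSEQ_le[OF lim[OF f] lim[OF g]]) (auto intro: birkhoff_avg_mono)
  next
    show "lim (birkhoff_avg T (\<lambda>_. 1) x) = 1"
      by (intro limI tendsto_eventually eventually_sequentiallyI[of 1]) (simp add: birkhoff_avg_const)
  qed (rule c)
qed

text \<open>The two sums differ by a telescoping pair of end terms, which stay bounded and vanish
  after division by \<open>n\<close>.\<close>

lemma birkhoff_avg_comp_tendsto: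
  fixes T :: "'a::metric_space \<Rightarrow> 'a"
  assumes c: "compact (UNIV :: 'a set)" and f: "continuous_on UNIV f"
    and l: "birkhoff_avg T f x \<longlonglongrightarrow> l"
  shows "birkhoff_avg T (\<lambda>y. f (T y)) x \<longlonglongrightarrow> l"
proof -
  obtain B where B: "\<And>x. norm (f x) \<le> B"
    using compact_imp_bounded[OF compact_continuous_image[OF f c]] by (auto simp: bounded_iff)
  have eq: "birkhoff_avg T (\<lambda>y. f (T y)) x n - birkhoff_avg T f x n
      = (f ((T ^^ Suc n) x) - f (T x)) / real n" for n
  proof -
    have "(\<Sum>k=1..n. f ((T ^^ Suc k) x) - f ((T ^^ k) x)) = f ((T ^^ Suc n) x) - f (T x)"
      by (induction n) simp_all
    then show ?thesis
      by (simp add: birkhoff_avg_def sum_subtractf diff_divide_distrib[symmetric])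
  qed
  have "(\<lambda>n. (f ((T ^^ Suc n) x) - f (T x)) / real n) \<longlonglongrightarrow> 0"
  proof (rule Lim_null_comparison)
    have "norm ((f ((T ^^ Suc n) x) - f (T x)) / real n) \<le> 2 * B / real n" for n
      using B[of "(T ^^ Suc n) x"] B[of "T x"] by (auto simp: abs_divide intro!: divide_right_mono)
    then show "eventually (\<lambda>n. norm ((f ((T ^^ Suc n) x) - f (T x)) / real n) \<le> 2 * B / real n) sequentially"
      by simp
    show "(\<lambda>n. 2 * B / real n) \<longlonglongrightarrow> 0" by (rule lim_const_over_n)
  qed
  from tendsto_add[OF this[folded eq] l] show ?thesis by simp
qed

text \<open>By \<open>birkhoff_avg_comp_tendsto\<close> the limits for \<open>f\<close> and for
  \<open>f\<close> composed with \<open>T\<close> agree. So the representing measure and its image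
  under \<open>T\<close> have the same integrals of continuous functions, and
  \<open>prob_measure_eqI\<close> identifies them.\<close>

lemma ex_invariant_measure_of_generic:
  fixes T :: "'a::metric_space \<Rightarrow> 'a"
  assumes c: "compact (UNIV :: 'a set)" and T: "continuous_on UNIV T" and x: "x \<in> generic_points T"
  obtains \<mu> where "\<mu> \<in> invariant_measures T" "x \<in> basin T \<mu>"
proof -
  interpret normalized_positive_functional "\<lambda>f. lim (birkhoff_avg T f x)"
    by (rule birkhoff_limit_functional[OF c x])
  let ?\<mu> = representing_measure
  interpret prob_space ?\<mu> by (rule prob_space_representing)
  have lim: "birkhoff_avg T f x \<longlonglongrightarrow> (LINT y|?\<mu>. f y)" if "continuous_on UNIV f" for f
    using x that by (simp add: generic_points_iff convergent_LIMSEQ_iff integral_representing)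
  have Tm: "T \<in> measurable ?\<mu> borel"
    by (simp add: measurable_cong_sets[OF sets_representing refl] borel_measurable_continuous_onI T)
  have "distr ?\<mu> borel T = ?\<mu>"
  proof (rule prob_measure_eqI)
    fix f :: "'a \<Rightarrow> real" assume f: "continuous_on UNIV f"
    have "(LINT y|distr ?\<mu> borel T. f y) = (LINT y|?\<mu>. f (T y))"
      by (rule integral_distr[OF Tm borel_measurable_continuous_onI[OF f]])
    also have "\<dots> = (LINT y|?\<mu>. f y)"
      using lim[of "\<lambda>y. f (T y)"] birkhoff_avg_comp_tendsto[OF c f lim[OF f]] T f
      by (intro LIMSEQ_unique) (auto intro: continuous_on_compose2)
    finally show "(LINT y|distr ?\<mu> borel T. f y) = (LINT y|?\<mu>. f y)" .
  qed (auto intro: prob_space_distr Tm prob_space_axioms)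
  then have "emeasure ?\<mu> (T -` A) = emeasure ?\<mu> A" if "A \<in> sets borel" for A
    using emeasure_distr[OF Tm that] by simp
  then have "?\<mu> \<in> invariant_measures T"
    using representing_measure_in_prob_measures by (simp add: invariant_measures_def)
  moreover have "x \<in> basin T ?\<mu>"
    using lim representing_measure_in_prob_measures by (simp add: basin_iff[OF c])
  ultimately show ?thesis by (rule that)
qed

subsection \<open>Measurability\<close>

lemma continuous_on_Min_image:
  fixes f :: "'i \<Rightarrow> 'a::topological_space \<Rightarrow> real"
  assumes "finite P" "P \<noteq> {}" "\<And>p. p \<in> P \<Longrightarrow> continuous_on S (f p)"
  shows "continuous_on S (\<lambda>x. Min ((\<lambda>p. f p x) ` P))"
  using assms
proof (induction P rule: finite_ne_induct)
  case (insert p P)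
  then have "(\<lambda>x. Min ((\<lambda>p. f p x) ` insert p P)) = (\<lambda>x. min (f p x) (Min ((\<lambda>p. f p x) ` P)))"
    by simp
  then show ?case using insert by (auto intro!: continuous_intros)
qed simp

text \<open>Minima of finitely many cones \<open>x \<mapsto> q + k d(x, p)\<close> with rational \<open>q\<close>, apex \<open>p\<close> in a countable
  dense set and integral slope \<open>k\<close> are uniformly dense: for large \<open>k\<close>, the cone with apex \<open>p\<close> and
  \<open>q \<approx> f p\<close> lies above \<open>f\<close> up to a small error, and is close to \<open>f\<close> near \<open>p\<close>.\<close>

lemma ex_uniformly_dense_sequence:
  assumes c: "compact (UNIV :: 'a::metric_space set)"
  obtains g :: "nat \<Rightarrow> 'a::metric_space \<Rightarrow> real" where "\<And>i. continuous_on UNIV (g i)"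
    "\<And>f e. continuous_on UNIV f \<Longrightarrow> 0 < e \<Longrightarrow> \<exists>i. \<forall>x. \<bar>f x - g i x\<bar> \<le> e"
proof -
  have "\<forall>n. \<exists>k. finite k \<and> (UNIV :: 'a set) \<subseteq> (\<Union>x\<in>k. ball x (1 / real (Suc n)))"
    using c unfolding compact_eq_totally_bounded by auto
  then obtain D where D: "\<And>n. finite (D n)" "\<And>n. (UNIV :: 'a set) \<subseteq> (\<Union>x\<in>D n. ball x (1 / real (Suc n)))"
    by metis
  define Z where "Z = (\<rat> :: real set) \<times> (\<Union>n. D n)"
  have "countable (\<Union>n. D n)" using D(1) by (auto intro: countable_finite)
  then have cZ: "countable Z" unfolding Z_def by (intro countable_SIGMA countable_rat)
  define h where "h P k x = Min ((\<lambda>r. fst r + real k * dist x (snd r)) ` P)" for P and k :: nat and x :: 'a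
  define G where "G = (\<lambda>(P, k). h P k) ` ({P. finite P \<and> P \<noteq> {} \<and> P \<subseteq> Z} \<times> UNIV)"
  have dense: "\<exists>g\<in>G. \<forall>x. \<bar>f x - g x\<bar> \<le> e" if f: "continuous_on UNIV f" and e: "0 < e" for f and e :: real
  proof -
    \<comment> \<open>Three errors add up in the upper estimate: \<open>q p\<close> against
      \<open>f p\<close>, the rise of the cone from its apex to \<open>x\<close>, and
      \<open>f p\<close> against \<open>f x\<close>.\<close>
    define e' where "e' = e / 3"
    have e': "0 < e'" using e by (simp add: e'_def)
    obtain B where B: "\<And>x. norm (f x) \<le> B"
      using compact_imp_bounded[OF compact_continuous_image[OF f c]] by (auto simp: bounded_iff)
    obtain \<delta> where \<delta>: "0 < \<delta>" "\<And>x y. dist x y < \<delta> \<Longrightarrow> dist (f x) (f y) < e'"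
      using compact_uniformly_continuous[OF f c] e' unfolding uniformly_continuous_on_def
      by (metis UNIV_I dist_commute)
    \<comment> \<open>At distance \<open>\<delta>\<close> from its apex a cone of slope
      \<open>k\<close> has risen by at least \<open>2 * B\<close>, which bounds the oscillation of
      \<open>f\<close>, so from there on it stays above \<open>f\<close>.\<close>
    obtain k :: nat where k: "2 * B / \<delta> < real k" "0 < k"
      using reals_Archimedean2[of "max 0 (2 * B / \<delta>)"] by auto
    have k2: "2 * B \<le> real k * \<delta>" using k(1) \<delta>(1) by (simp add: field_simps)
    have "0 < min \<delta> (e' / real k)" using \<delta> e' k by simp
    then obtain n where n: "1 / real (Suc n) < min \<delta> (e' / real k)"
      by (rule nat_approx_posE)
    have "\<forall>p. \<exists>q\<in>\<rat>. f p < q \<and> q < f p + e'" using Rats_dense_in_real e' by simp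
    then obtain q where q: "\<And>p. q p \<in> \<rat>" "\<And>p. f p < q p" "\<And>p. q p < f p + e'" by metis
    define P where "P = (\<lambda>p. (q p, p)) ` D n"
    have P: "finite P" "P \<noteq> {}" "P \<subseteq> Z" using D(1) D(2)[of n] q(1) by (auto simp: P_def Z_def)
    have "\<bar>f x - h P k x\<bar> \<le> e" for x
    proof -
      have "x \<in> (\<Union>p\<in>D n. ball p (1 / real (Suc n)))" using D(2)[of n] by blast
      then obtain p where p: "p \<in> D n" "dist p x < 1 / real (Suc n)" by auto
      then have "dist x p < \<delta>" and *: "dist x p < e' / real k" using n by (auto simp: dist_commute)
      then have "dist (f x) (f p) < e'" using \<delta> by auto
      moreover have "real k * dist x p < e'" using * k by (simp add: field_simps)
      moreover have "h P k x \<le> q p + real k * dist x p"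
        unfolding h_def using D(1) p(1) by (intro Min_le) (auto simp: P_def image_image)
      ultimately have "h P k x \<le> f x + e" using q(3)[of p] unfolding dist_real_def e'_def by linarith
      moreover have "f x - e' \<le> h P k x"
        unfolding h_def
      proof (rule Min.boundedI)
        fix a assume "a \<in> (\<lambda>r. fst r + real k * dist x (snd r)) ` P"
        then obtain p where a: "a = q p + real k * dist x p" by (auto simp: P_def)
        show "f x - e' \<le> a"
        proof (cases "dist x p < \<delta>")
          case True
          then have "dist (f x) (f p) < e'" using \<delta> by auto
          moreover have "0 \<le> real k * dist x p" by simp
          ultimately show ?thesis using q(2)[of p] a unfolding dist_real_def by linarith
        next
          case False
          then have "real k * \<delta> \<le> real k * dist x p" by (intro mult_left_mono) auto
          then show ?thesis using B[of x] B[of p] k2 a q(2)[of p] e' unfolding real_norm_def by linarith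
        qed
      qed (use P in auto)
      ultimately show ?thesis using e' by (simp add: e'_def abs_le_iff)
    qed
    moreover have "h P k \<in> G" using P by (auto simp: G_def)
    ultimately show ?thesis by blast
  qed
  have "countable {P. finite P \<and> P \<noteq> {} \<and> P \<subseteq> Z}"
    by (rule countable_subset[OF _ countable_Collect_finite_subset[OF cZ]]) auto
  then have "countable G" unfolding G_def by (intro countable_image countable_SIGMA) auto
  moreover have "G \<noteq> {}" using dense[of "\<lambda>_. 0" 1] by auto
  ultimately have range: "range (from_nat_into G) = G" by (rule range_from_nat_into[rotated])
  have "continuous_on UNIV g" if "g \<in> G" for g
    using that unfolding G_def h_def by (auto intro!: continuous_on_Min_image continuous_intros)
  then have "continuous_on UNIV (from_nat_into G i)" for i using range by blast
  moreover have "\<exists>i. \<forall>x. \<bar>f x - from_nat_into G i x\<bar> \<le> e"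
    if "continuous_on UNIV f" "0 < e" for f and e :: real
  proof -
    from dense[OF that] obtain g where "g \<in> G" "\<forall>x. \<bar>f x - g x\<bar> \<le> e" by blast
    moreover then obtain i where "g = from_nat_into G i" using range by blast
    ultimately show ?thesis by blast
  qed
  ultimately show ?thesis by (rule that)
qed

section \<open>Genericity and equal limits tested on a countable family\<close>

lemma birkhoff_avg_close:
  "(\<And>z. \<bar>f z - g z\<bar> \<le> e) \<Longrightarrow> \<bar>birkhoff_avg T f x n - birkhoff_avg T g x n\<bar> \<le> e"
  using abs_birkhoff_avg_le[where f = "\<lambda>z. f z - g z"] by (simp add: birkhoff_avg_diff)

text \<open>Genericity is part of the relation because \<open>lim\<close> of a divergent sequence is
  an unspecified value, and equality of such values would mean nothing.\<close>

definition same_limits :: "('a::topological_space \<Rightarrow> 'a) \<Rightarrow> ('a \<times> 'a) set" where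
  "same_limits T = {(x, y). x \<in> generic_points T \<and> y \<in> generic_points T \<and>
     (\<forall>f. continuous_on UNIV f \<longrightarrow> lim (birkhoff_avg T f x) = lim (birkhoff_avg T f y))}"

lemma generic_pointsD:
  "x \<in> generic_points T \<Longrightarrow> continuous_on UNIV f \<Longrightarrow> birkhoff_avg T f x \<longlonglongrightarrow> lim (birkhoff_avg T f x)"
  by (simp add: generic_points_iff convergent_LIMSEQ_iff)

text \<open>A uniform approximation of \<open>f\<close> moves all its averages by at most the same
  error, whatever \<open>n\<close> is, so the Cauchy property carries over from the approximating
  \<open>g i\<close>.\<close>

lemma generic_points_dense_iff:
  assumes g: "\<And>i. continuous_on UNIV (g i)"
    "\<And>f e. continuous_on UNIV f \<Longrightarrow> 0 < e \<Longrightarrow> \<exists>i::nat. \<forall>x. \<bar>f x - g i x :: real\<bar> \<le> e"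
  shows "x \<in> generic_points T \<longleftrightarrow> (\<forall>i. convergent (birkhoff_avg T (g i) x))"
proof
  assume r: "\<forall>i. convergent (birkhoff_avg T (g i) x)"
  show "x \<in> generic_points T"
    unfolding generic_points_iff
  proof (intro allI impI)
    fix f :: "'a \<Rightarrow> real" assume f: "continuous_on UNIV f"
    show "convergent (birkhoff_avg T f x)"
      unfolding Cauchy_convergent_iff[symmetric]
    proof (rule metric_CauchyI)
      fix e :: real assume "0 < e"
      then obtain i where i: "\<And>z. \<bar>f z - g i z\<bar> \<le> e / 4" using g(2)[OF f, of "e/4"] by auto
      from r have "Cauchy (birkhoff_avg T (g i) x)" by (simp add: Cauchy_convergent_iff)
      then obtain M where M: "\<And>m n. m \<ge> M \<Longrightarrow> n \<ge> M \<Longrightarrow> dist (birkhoff_avg T (g i) x m) (birkhoff_avg T (g i) x n) < e / 4"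
        using \<open>0 < e\<close> unfolding Cauchy_def by (metis zero_less_divide_iff zero_less_numeral)
      have "dist (birkhoff_avg T f x m) (birkhoff_avg T f x n) < e" if "m \<ge> M" "n \<ge> M" for m n
        using M[OF that] birkhoff_avg_close[of f "g i", OF i, of T x m] birkhoff_avg_close[of f "g i", OF i, of T x n] \<open>0 < e\<close>
        unfolding dist_real_def by linarith
      then show "\<exists>M. \<forall>m\<ge>M. \<forall>n\<ge>M. dist (birkhoff_avg T f x m) (birkhoff_avg T f x n) < e" by blast
    qed
  qed
qed (use g in \<open>auto simp: generic_points_iff\<close>)

lemma same_limits_dense_iff:
  assumes g: "\<And>i. continuous_on UNIV (g i)"
    "\<And>f e. continuous_on UNIV f \<Longrightarrow> 0 < e \<Longrightarrow> \<exists>i::nat. \<forall>x. \<bar>f x - g i x :: real\<bar> \<le> e"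
    and x: "x \<in> generic_points T" and y: "y \<in> generic_points T"
  shows "(x, y) \<in> same_limits T \<longleftrightarrow> (\<forall>i. lim (birkhoff_avg T (g i) x) = lim (birkhoff_avg T (g i) y))"
proof
  assume r: "\<forall>i. lim (birkhoff_avg T (g i) x) = lim (birkhoff_avg T (g i) y)"
  have "lim (birkhoff_avg T f x) = lim (birkhoff_avg T f y)" if f: "continuous_on UNIV f" for f
  proof -
    have "\<bar>lim (birkhoff_avg T f x) - lim (birkhoff_avg T f y)\<bar> \<le> 0 + e" if e: "0 < e" for e
    proof -
      obtain i where i: "\<And>z. \<bar>f z - g i z\<bar> \<le> e / 2" using g(2)[OF f, of "e/2"] e by auto
      have "\<bar>lim (birkhoff_avg T f z) - lim (birkhoff_avg T (g i) z)\<bar> \<le> e / 2" if "z \<in> generic_points T" for z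
        by (rule tendsto_upperbound[OF tendsto_rabs[OF tendsto_diff[OF generic_pointsD[OF that f] generic_pointsD[OF that g(1)]]]])
          (use birkhoff_avg_close[of f "g i", OF i] in simp_all)
      moreover have "lim (birkhoff_avg T (g i) x) = lim (birkhoff_avg T (g i) y)" using r by blast
      ultimately show ?thesis using x y by (smt (verit) field_sum_of_halves)
    qed
    then have "\<bar>lim (birkhoff_avg T f x) - lim (birkhoff_avg T f y)\<bar> \<le> 0" by (rule field_le_epsilon)
    then show ?thesis by simp
  qed
  then show "(x, y) \<in> same_limits T" using x y by (simp add: same_limits_def)
qed (use g in \<open>auto simp: same_limits_def\<close>)

lemma continuous_on_funpow:
  "continuous_on UNIV T \<Longrightarrow> continuous_on UNIV (T ^^ k)" for T :: "'a::topological_space \<Rightarrow> 'a"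
proof (induction k)
  case (Suc k)
  have "continuous_on UNIV (\<lambda>x. T ((T ^^ k) x))"
    by (rule continuous_on_compose2[OF Suc.prems Suc.IH[OF Suc.prems]]) auto
  then show ?case by (simp add: comp_def)
qed (simp add: id_def)

lemma borel_measurable_birkhoff_avg:
  fixes T :: "'a::topological_space \<Rightarrow> 'a"
  assumes "continuous_on UNIV T" "continuous_on UNIV f"
  shows "(\<lambda>x. birkhoff_avg T f x n) \<in> borel_measurable borel"
  unfolding birkhoff_avg_def
  by (intro borel_measurable_continuous_onI continuous_intros
      continuous_on_compose2[OF assms(2) continuous_on_funpow[OF assms(1)]]) auto

lemma generic_points_borel:
  fixes T :: "'a::metric_space \<Rightarrow> 'a"
  assumes c: "compact (UNIV :: 'a set)" and T: "continuous_on UNIV T"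
  shows "generic_points T \<in> sets borel"
proof -
  obtain g :: "nat \<Rightarrow> 'a \<Rightarrow> real" where g: "\<And>i. continuous_on UNIV (g i)"
    "\<And>f e. continuous_on UNIV f \<Longrightarrow> 0 < e \<Longrightarrow> \<exists>i. \<forall>x. \<bar>f x - g i x\<bar> \<le> e"
    using ex_uniformly_dense_sequence[OF c] by metis
  have "{x \<in> space borel. Cauchy (birkhoff_avg T (g i) x)} \<in> sets borel" for i
    by (rule sets_Collect_Cauchy[of "\<lambda>n x. birkhoff_avg T (g i) x n"])
      (rule borel_measurable_birkhoff_avg[OF T g(1)])
  then have "{x \<in> space borel. \<forall>i. Cauchy (birkhoff_avg T (g i) x)} \<in> sets borel"
    by (rule sets.sets_Collect_countable_All)
  moreover have "generic_points T = {x \<in> space borel. \<forall>i. Cauchy (birkhoff_avg T (g i) x)}"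
    using generic_points_dense_iff[OF g] by (auto simp: Cauchy_convergent_iff)
  ultimately show ?thesis by simp
qed

lemma same_limits_measurable:
  fixes T :: "'a::metric_space \<Rightarrow> 'a"
  assumes c: "compact (UNIV :: 'a set)" and T: "continuous_on UNIV T" and m: "sets m = sets borel"
  shows "same_limits T \<in> sets (m \<Otimes>\<^sub>M m)"
proof -
  obtain g :: "nat \<Rightarrow> 'a \<Rightarrow> real" where g: "\<And>i. continuous_on UNIV (g i)"
    "\<And>f e. continuous_on UNIV f \<Longrightarrow> 0 < e \<Longrightarrow> \<exists>i. \<forall>x. \<bar>f x - g i x\<bar> \<le> e"
    using ex_uniformly_dense_sequence[OF c] by metis
  have space: "space m = UNIV" using sets_eq_imp_space_eq[OF m] by simp
  \<comment> \<open>The total function \<open>lim\<close> is measurable even where the averages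
    diverge; intersecting with the generic points below discards its arbitrary values.\<close>
  have lm: "(\<lambda>x. lim (birkhoff_avg T (g i) x)) \<in> borel_measurable m" for i
    unfolding measurable_cong_sets[OF m refl]
    by (rule borel_measurable_lim_metric[of "\<lambda>n x. birkhoff_avg T (g i) x n"])
      (rule borel_measurable_birkhoff_avg[OF T g(1)])
  have "{p \<in> space (m \<Otimes>\<^sub>M m). lim (birkhoff_avg T (g i) (fst p)) = lim (birkhoff_avg T (g i) (snd p))} \<in> sets (m \<Otimes>\<^sub>M m)"
    for i
    by (intro borel_measurable_eq measurable_compose[OF measurable_fst lm]
        measurable_compose[OF measurable_snd lm])
  then have "{p \<in> space (m \<Otimes>\<^sub>M m). \<forall>i. lim (birkhoff_avg T (g i) (fst p)) = lim (birkhoff_avg T (g i) (snd p))} \<in> sets (m \<Otimes>\<^sub>M m)"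
    by (rule sets.sets_Collect_countable_All)
  moreover have "generic_points T \<times> generic_points T \<in> sets (m \<Otimes>\<^sub>M m)"
    using generic_points_borel[OF c T] m by auto
  moreover have eq: "same_limits T = (generic_points T \<times> generic_points T) \<inter>
      {p \<in> space (m \<Otimes>\<^sub>M m). \<forall>i. lim (birkhoff_avg T (g i) (fst p)) = lim (birkhoff_avg T (g i) (snd p))}"
  proof -
    have "p \<in> same_limits T \<longleftrightarrow> p \<in> (generic_points T \<times> generic_points T) \<and>
        (\<forall>i. lim (birkhoff_avg T (g i) (fst p)) = lim (birkhoff_avg T (g i) (snd p)))" for p
    proof (cases "p \<in> generic_points T \<times> generic_points T")
      case True
      then show ?thesis using same_limits_dense_iff[OF g, where x = "fst p" and y = "snd p" and T = T]
        by auto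
    next
      case False
      then show ?thesis by (auto simp: same_limits_def)
    qed
    then show ?thesis by (auto simp: space_pair_measure space)
  qed
  ultimately show ?thesis unfolding eq by (intro sets.Int)
qed

text \<open>Measurability of the basin follows, because sections of a measurable relation are
  measurable. As the equation holds at every \<open>x\<close> in the basin, the square of the basin
  lies inside the relation.\<close>

lemma basin_eq_section:
  fixes T :: "'a::metric_space \<Rightarrow> 'a"
  assumes c: "compact (UNIV :: 'a set)" and x: "x \<in> basin T \<mu>"
  shows "basin T \<mu> = Pair x -` same_limits T"
proof -
  have *: "y \<in> generic_points T \<and> (\<forall>f. continuous_on UNIV f \<longrightarrow> lim (birkhoff_avg T f y) = (LINT z|\<mu>. f z))"
    if "y \<in> basin T \<mu>" for y
    using that by (auto simp: basin_iff[OF c] generic_points_iff intro: convergentI limI)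
  have "y \<in> basin T \<mu>" if "(x, y) \<in> same_limits T" for y
  proof -
    have "birkhoff_avg T f y \<longlonglongrightarrow> (LINT z|\<mu>. f z)" if f: "continuous_on UNIV f" for f
      using generic_pointsD[of y T f] *[OF x] f \<open>(x, y) \<in> same_limits T\<close>
      by (auto simp: same_limits_def)
    then show ?thesis using x by (simp add: basin_iff[OF c])
  qed
  moreover have "(x, y) \<in> same_limits T" if "y \<in> basin T \<mu>" for y
    using *[OF x] *[OF that] by (simp add: same_limits_def)
  ultimately show ?thesis by blast
qed

subsection \<open>Matchings of orbit segments\<close>

text \<open>Regard \<open>a\<close> and \<open>b\<close> as colourings of the times. For each colour
  as many times as possible are paired, namely the smaller of the two counts, and the remaining
  times are paired arbitrarily. Mismatches thus occur only among the surplus of \<open>a\<close> in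
  each colour.\<close>

lemma ex_permutation_few_mismatches:
  fixes a b :: "nat \<Rightarrow> 'c"
  assumes I: "finite I" "a ` {1..n} \<subseteq> I" "b ` {1..n} \<subseteq> I"
  obtains \<sigma> where "\<sigma> permutes {1..n}"
    "real (card {k\<in>{1..n}. a k \<noteq> b (\<sigma> k)})
      \<le> (\<Sum>i\<in>I. \<bar>real (card {k\<in>{1..n}. a k = i}) - real (card {k\<in>{1..n}. b k = i})\<bar>)"
proof -
  let ?N = "{1..n}"
  define A where "A i = {k\<in>?N. a k = i}" for i
  define B where "B i = {k\<in>?N. b k = i}" for i
  have fin: "finite (A i)" "finite (B i)" for i by (auto simp: A_def B_def)
  have "\<forall>i. \<exists>S R h. S \<subseteq> A i \<and> R \<subseteq> B i \<and> card S = min (card (A i)) (card (B i)) \<and> bij_betw h S R"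
  proof
    fix i
    obtain S where S: "S \<subseteq> A i" "card S = min (card (A i)) (card (B i))" "finite S"
      using obtain_subset_with_card_n[of "min (card (A i)) (card (B i))" "A i"] by auto
    obtain R where R: "R \<subseteq> B i" "card R = min (card (A i)) (card (B i))" "finite R"
      using obtain_subset_with_card_n[of "min (card (A i)) (card (B i))" "B i"] by auto
    obtain h where "bij_betw h S R" using finite_same_card_bij[OF S(3) R(3)] S R by auto
    with S R show "\<exists>S R h. S \<subseteq> A i \<and> R \<subseteq> B i \<and> card S = min (card (A i)) (card (B i)) \<and> bij_betw h S R"
      by blast
  qed
  then obtain S R h where S: "\<And>i. S i \<subseteq> A i" and R: "\<And>i. R i \<subseteq> B i"
    and card_S: "\<And>i. card (S i) = min (card (A i)) (card (B i))"
    and h: "\<And>i. bij_betw (h i) (S i) (R i)" by metis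
  define U where "U = (\<Union>i\<in>I. S i)"
  define g where "g k = h (a k) k" for k
  have aS: "a k = i" if "k \<in> S i" for k i using that S[of i] by (auto simp: A_def)
  have bg: "b (g k) = a k" "g k \<in> ?N" if "k \<in> U" for k
  proof -
    from that obtain i where "k \<in> S i" by (auto simp: U_def)
    then have "g k \<in> R (a k)" using aS h[of i] by (auto simp: g_def bij_betw_def)
    then show "b (g k) = a k" "g k \<in> ?N" using R[of "a k"] by (auto simp: B_def)
  qed
  have inj: "inj_on g U"
  proof (rule inj_onI)
    fix k l assume k: "k \<in> U" "l \<in> U" "g k = g l"
    then have e: "a k = a l" using bg by metis
    have "k \<in> S (a k)" "l \<in> S (a l)" using k aS by (auto simp: U_def)
    then show "k = l" using k(3) e h[of "a k"] by (auto simp: g_def bij_betw_def inj_on_def)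
  qed
  have UN: "U \<subseteq> ?N" using S unfolding U_def A_def by blast
  have gN: "g ` U \<subseteq> ?N" using bg by auto
  \<comment> \<open>Injectivity of \<open>g\<close> leaves equally many times over on both
    sides.\<close>
  have "card (?N - U) = card (?N - g ` U)"
    using UN gN card_image[OF inj] by (simp add: card_Diff_subset finite_subset)
  then obtain c where c: "bij_betw c (?N - U) (?N - g ` U)"
    using finite_same_card_bij[of "?N - U" "?N - g ` U"] by auto
  define \<sigma> where "\<sigma> k = (if k \<in> U then g k else if k \<in> ?N then c k else k)" for k
  have "bij_betw \<sigma> (U \<union> (?N - U)) (g ` U \<union> (?N - g ` U))"
  proof (rule bij_betw_combine)
    show "bij_betw \<sigma> U (g ` U)"
      using inj by (subst bij_betw_cong[of U \<sigma> g]) (auto simp: \<sigma>_def bij_betw_def)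
    show "bij_betw \<sigma> (?N - U) (?N - g ` U)"
      using c by (subst bij_betw_cong[of "?N - U" \<sigma> c]) (auto simp: \<sigma>_def)
  qed auto
  then have "bij_betw \<sigma> ?N ?N" using UN gN by (simp add: Un_absorb1)
  then have perm: "\<sigma> permutes ?N"
    using UN by (intro bij_imp_permutes) (auto simp: \<sigma>_def)
  have "{k\<in>?N. a k \<noteq> b (\<sigma> k)} \<subseteq> (\<Union>i\<in>I. A i - S i)"
  proof
    fix k assume k: "k \<in> {k\<in>?N. a k \<noteq> b (\<sigma> k)}"
    then have "k \<notin> U" using bg(1)[of k] by (auto simp: \<sigma>_def)
    moreover have "a k \<in> I" using k I by auto
    ultimately show "k \<in> (\<Union>i\<in>I. A i - S i)" using k by (auto simp: A_def U_def)
  qed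
  then have "card {k\<in>?N. a k \<noteq> b (\<sigma> k)} \<le> card (\<Union>i\<in>I. A i - S i)"
    using fin I by (intro card_mono) auto
  also have "\<dots> \<le> (\<Sum>i\<in>I. card (A i - S i))" by (rule card_UN_le[OF I(1)])
  finally have "real (card {k\<in>?N. a k \<noteq> b (\<sigma> k)}) \<le> (\<Sum>i\<in>I. real (card (A i - S i)))"
    by (metis of_nat_le_iff of_nat_sum)
  also have "\<dots> \<le> (\<Sum>i\<in>I. \<bar>real (card (A i)) - real (card (B i))\<bar>)"
  proof (rule sum_mono)
    fix i
    have "card (A i - S i) = card (A i) - min (card (A i)) (card (B i))"
      using S[of i] fin(1)[of i] card_S[of i] by (simp add: card_Diff_subset finite_subset)
    then show "real (card (A i - S i)) \<le> \<bar>real (card (A i)) - real (card (B i))\<bar>" by auto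
  qed
  finally show ?thesis using perm that unfolding A_def B_def by blast
qed

section \<open>Partitions into small pieces with light boundaries\<close>

context normalized_positive_functional
begin

text \<open>Sets whose indicator function is squeezed between two continuous functions on which \<open>L\<close>
  differs by at most \<open>\<eta>\<close>. They play the role of continuity sets of the representing measure.\<close>

definition squeezed :: "real \<Rightarrow> 'a set \<Rightarrow> bool" where
  "squeezed \<eta> A \<longleftrightarrow> (\<exists>g h. continuous_on UNIV g \<and> continuous_on UNIV h \<and>
     (\<forall>x. 0 \<le> g x \<and> g x \<le> indicator A x \<and> indicator A x \<le> h x \<and> h x \<le> 1) \<and> L h - L g \<le> \<eta>)"

lemma diff: "continuous_on UNIV f \<Longrightarrow> continuous_on UNIV g \<Longrightarrow> L (\<lambda>x. f x - g x) = L f - L g"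
  using add[of f "\<lambda>x. - 1 * g x"] scale[of g "- 1"] by (simp add: continuous_on_minus)

lemma squeezed_UNIV: "squeezed 0 UNIV"
  unfolding squeezed_def by (intro exI[of _ "\<lambda>_. 1"]) auto

lemma squeezed_mono: "squeezed \<eta> A \<Longrightarrow> \<eta> \<le> \<eta>' \<Longrightarrow> squeezed \<eta>' A"
  unfolding squeezed_def by (meson order_trans)

lemma squeezed_Compl: "squeezed \<eta> A \<Longrightarrow> squeezed \<eta> (- A)"
proof -
  assume "squeezed \<eta> A"
  then obtain g h where gh: "continuous_on UNIV g" "continuous_on UNIV h"
     "\<And>x. 0 \<le> g x \<and> g x \<le> indicator A x \<and> indicator A x \<le> h x \<and> h x \<le> 1" "L h - L g \<le> \<eta>"
    by (auto simp: squeezed_def)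
  have "L (\<lambda>x. 1 - g x) - L (\<lambda>x. 1 - h x) = L h - L g"
    using diff[of "\<lambda>_. 1" g] diff[of "\<lambda>_. 1" h] gh by simp
  then show ?thesis
    using gh unfolding squeezed_def
    by (intro exI[of _ "\<lambda>x. 1 - h x"] exI[of _ "\<lambda>x. 1 - g x"])
      (auto intro!: continuous_intros simp: indicator_compl)
qed

lemma squeezed_Int:
  assumes "squeezed \<eta> A" "squeezed \<eta>' B" shows "squeezed (\<eta> + \<eta>') (A \<inter> B)"
proof -
  from assms(1) obtain g h where gh: "continuous_on UNIV g" "continuous_on UNIV h"
     "\<And>x. 0 \<le> g x \<and> g x \<le> indicator A x \<and> indicator A x \<le> h x \<and> h x \<le> 1" "L h - L g \<le> \<eta>"
    by (auto simp: squeezed_def)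
  from assms(2) obtain g' h' where gh': "continuous_on UNIV g'" "continuous_on UNIV h'"
     "\<And>x. 0 \<le> g' x \<and> g' x \<le> indicator B x \<and> indicator B x \<le> h' x \<and> h' x \<le> 1" "L h' - L g' \<le> \<eta>'"
    by (auto simp: squeezed_def)
  have bounds: "0 \<le> g x * g' x \<and> g x * g' x \<le> indicator (A \<inter> B) x \<and> indicator (A \<inter> B) x \<le> h x * h' x \<and> h x * h' x \<le> 1" for x
  proof -
    have h0: "0 \<le> h x" "0 \<le> h' x" using gh(3)[of x] gh'(3)[of x] indicator_pos_le order_trans by blast+
    then show ?thesis using gh(3)[of x] gh'(3)[of x]
      unfolding indicator_inter_arith by (auto intro: mult_mono mult_le_one)
  qed
  \<comment> \<open>The difference equals \<open>h x * (h' x - g' x) + g' x * (h x - g x)\<close>,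
    where both outer factors are at most 1.\<close>
  have "h x * h' x - g x * g' x \<le> (h x - g x) + (h' x - g' x)" for x
  proof -
    have *: "g x \<le> h x" "g' x \<le> h' x" "0 \<le> h x" "h x \<le> 1" "0 \<le> g' x" "g' x \<le> 1"
      using gh(3)[of x] gh'(3)[of x] by linarith+
    have "h x * (h' x - g' x) \<le> 1 * (h' x - g' x)" "g' x * (h x - g x) \<le> 1 * (h x - g x)"
      using * by (intro mult_right_mono; simp)+
    then show ?thesis by (simp add: algebra_simps)
  qed
  then have "L (\<lambda>x. h x * h' x - g x * g' x) \<le> L (\<lambda>x. (h x - g x) + (h' x - g' x))"
    by (intro mono) (auto intro!: continuous_intros gh gh')
  then have "L (\<lambda>x. h x * h' x) - L (\<lambda>x. g x * g' x) \<le> (L h - L g) + (L h' - L g')"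
    using gh gh' by (simp add: diff add continuous_on_diff continuous_on_mult)
  then show ?thesis
    using bounds gh gh' unfolding squeezed_def
    by (intro exI[of _ "\<lambda>x. g x * g' x"] exI[of _ "\<lambda>x. h x * h' x"]) (auto intro: continuous_on_mult)
qed

lemma squeezed_INT:
  assumes "finite J" "\<And>j. j \<in> J \<Longrightarrow> squeezed \<eta> (A j)"
  shows "squeezed (real (card J) * \<eta>) (\<Inter>j\<in>J. A j)"
  using assms
proof (induction J rule: finite_induct)
  case empty
  then show ?case using squeezed_UNIV by simp
next
  case (insert j J)
  then have "squeezed (\<eta> + real (card J) * \<eta>) (A j \<inter> (\<Inter>j\<in>J. A j))" by (intro squeezed_Int) auto
  then show ?case using insert by (simp add: algebra_simps)
qed

text \<open>The annuli between \<open>N\<close> equidistant radii share total mass at most 1, so one of them is light.\<close>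

lemma ex_squeezed_ball:
  assumes \<rho>: "0 < \<rho>" and \<eta>: "0 < (\<eta>::real)"
  obtains r where "\<rho> \<le> r" "r \<le> 2 * \<rho>" "squeezed \<eta> (ball p r)"
proof -
  \<comment> \<open>If all \<open>N\<close> increments below were at least \<open>\<eta>\<close>,
    their sum would exceed 1, although it telescopes to a value of at most 1.\<close>
  obtain N :: nat where N: "1 / \<eta> < real N" "0 < N"
    using reals_Archimedean2[of "max 0 (1 / \<eta>)"] by auto
  define s where "s = \<rho> / real N"
  have s: "0 < s" using \<rho> N by (simp add: s_def)
  define r where "r i = \<rho> + s * real i" for i
  \<comment> \<open>\<open>b i\<close> is 1 up to radius \<open>r i\<close> and 0 from radius
    \<open>r (Suc i)\<close> on. Hence \<open>b i\<close> and \<open>b (Suc i)\<close> enclose the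
    indicator of the ball of radius \<open>r (Suc i)\<close>.\<close>
  define b where "b i x = min 1 (max 0 ((r (Suc i) - dist p x) / s))" for i x
  have rS: "r (Suc i) = r i + s" for i by (simp add: r_def algebra_simps)
  have cb: "continuous_on UNIV (b i)" for i
    unfolding b_def using s by (intro continuous_intros) auto
  have b01: "0 \<le> b i x" "b i x \<le> 1" for i x by (auto simp: b_def)
  have "(\<Sum>i<N. L (b (Suc i)) - L (b i)) = L (b N) - L (b 0)" by (rule sum_lessThan_telescope)
  also have "\<dots> \<le> 1" using mono[OF cb, of "\<lambda>_. 1" N] nonneg[OF cb b01(1), of 0] one b01 by simp
  also have "1 < (\<Sum>i<N. \<eta>)" using N \<eta> by (simp add: field_simps)
  finally obtain i where i: "i < N" "L (b (Suc i)) - L (b i) < \<eta>"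
    by (metis (no_types, lifting) lessThan_iff not_less sum_mono)
  have "squeezed \<eta> (ball p (r (Suc i)))"
    unfolding squeezed_def
  proof (intro exI conjI allI cb)
    fix x
    show "b i x \<le> indicator (ball p (r (Suc i))) x"
      using s b01(2)[of i x] by (auto simp: b_def indicator_def divide_nonpos_pos)
    have "1 \<le> (r (Suc (Suc i)) - dist p x) / s" if "dist p x < r (Suc i)"
      using that s rS[of "Suc i"] by (simp add: field_simps)
    then show "indicator (ball p (r (Suc i))) x \<le> b (Suc i) x"
      using b01(1)[of "Suc i" x] by (auto simp: b_def indicator_def)
  qed (use i b01 cb in auto)
  moreover have "\<rho> \<le> r (Suc i)" using s by (simp add: r_def)
  moreover have "r (Suc i) \<le> 2 * \<rho>"
  proof -
    have "s * real (Suc i) \<le> s * real N" using s i by (intro mult_left_mono) auto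
    also have "\<dots> = \<rho>" using N by (simp add: s_def)
    finally show ?thesis by (simp add: r_def)
  qed
  ultimately show ?thesis using that by blast
qed

text \<open>The order of quantifiers matters: \<open>N\<close> depends on \<open>\<rho>\<close>
  alone, so \<open>\<eta>\<close> may later be chosen in terms of \<open>N\<close>. This works
  because the centres are fixed first and only the radii, between \<open>\<rho> / 4\<close> and
  \<open>\<rho> / 2\<close>, are adjusted to \<open>\<eta>\<close>.\<close>

lemma ex_squeezed_partition:
  assumes \<rho>: "0 < \<rho>"
  obtains N :: nat where
    "\<And>\<eta>::real. 0 < \<eta> \<Longrightarrow> \<exists>c :: 'a \<Rightarrow> nat. range c \<subseteq> {..<N} \<and> (\<forall>x y. c x = c y \<longrightarrow> dist x y < \<rho>) \<and>
       (\<forall>i<N. squeezed \<eta> {x. c x = i})"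
proof -
  obtain K where K: "finite K" "(UNIV :: 'a set) \<subseteq> (\<Union>x\<in>K. ball x (\<rho> / 4))"
    using compact_space \<rho> unfolding compact_eq_totally_bounded by (metis divide_pos_pos zero_less_numeral)
  define N where "N = card K"
  obtain p where p: "bij_betw p {..<N} K"
    using ex_bij_betw_nat_finite[OF K(1)] by (auto simp: N_def atLeast0LessThan)
  show ?thesis
  proof
    fix \<eta> :: real assume \<eta>: "0 < \<eta>"
    \<comment> \<open>A piece is a ball minus at most \<open>N\<close> earlier balls, and the errors
      of the intersected sets add up.\<close>
    define \<eta>' where "\<eta>' = \<eta> / real (Suc N)"
    have \<eta>': "0 < \<eta>'" using \<eta> by (simp add: \<eta>'_def)
    have "0 < \<rho> / 4" using \<rho> by simp
    then have "\<forall>i. \<exists>r. \<rho> / 4 \<le> r \<and> r \<le> 2 * (\<rho> / 4) \<and> squeezed \<eta>' (ball (p i) r)"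
      using ex_squeezed_ball[OF _ \<eta>'] by metis
    then obtain r where r: "\<And>i. \<rho> / 4 \<le> r i" "\<And>i. r i \<le> 2 * (\<rho> / 4)" "\<And>i. squeezed \<eta>' (ball (p i) (r i))"
      by metis
    have cover: "\<exists>i. i < N \<and> x \<in> ball (p i) (r i)" for x
    proof -
      have "x \<in> (\<Union>q\<in>K. ball q (\<rho> / 4))" using K by blast
      then obtain q where "q \<in> K" "dist q x < \<rho> / 4" by auto
      moreover then obtain i where "i < N" "q = p i" using p by (auto simp: bij_betw_def)
      ultimately show ?thesis using r(1)[of i] by (intro exI[of _ i]) auto
    qed
    \<comment> \<open>Taking the least index makes the overlapping balls disjoint: the piece
      \<open>i\<close> is ball \<open>i\<close> without the earlier balls.\<close>
    define c where "c x = (LEAST i. i < N \<and> x \<in> ball (p i) (r i))" for x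
    have c: "c x < N" "x \<in> ball (p (c x)) (r (c x))" for x
      using LeastI_ex[OF cover[of x]] by (auto simp: c_def)
    have "dist x y < \<rho>" if "c x = c y" for x y
    proof -
      have "dist (p (c x)) x < r (c x)" "dist (p (c x)) y < r (c x)" using c(2)[of x] c(2)[of y] that by auto
      moreover have "dist x y \<le> dist (p (c x)) x + dist (p (c x)) y" by (rule dist_triangle3)
      ultimately show ?thesis using r(2)[of "c x"] by simp
    qed
    moreover have "squeezed \<eta> {x. c x = i}" if i: "i < N" for i
    proof -
      have "c x = i \<longleftrightarrow> x \<in> ball (p i) (r i) \<and> (\<forall>j<i. x \<notin> ball (p j) (r j))" for x
      proof
        assume "c x = i"
        then show "x \<in> ball (p i) (r i) \<and> (\<forall>j<i. x \<notin> ball (p j) (r j))"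
          using c[of x] not_less_Least[of _ "\<lambda>i. i < N \<and> x \<in> ball (p i) (r i)"] i
          unfolding c_def by (metis (no_types, lifting) order.strict_trans)
      next
        assume "x \<in> ball (p i) (r i) \<and> (\<forall>j<i. x \<notin> ball (p j) (r j))"
        then show "c x = i" unfolding c_def using i by (intro Least_equality) (auto simp: not_less[symmetric])
      qed
      then have eq: "{x. c x = i} = ball (p i) (r i) \<inter> (\<Inter>j\<in>{..<i}. - ball (p j) (r j))" by auto
      have "squeezed (\<eta>' + real (card {..<i}) * \<eta>') {x. c x = i}"
        unfolding eq by (intro squeezed_Int squeezed_INT squeezed_Compl r) auto
      moreover have "\<eta>' + real (card {..<i}) * \<eta>' = real (Suc i) * \<eta>'" by (simp add: algebra_simps)
      moreover have "real (Suc i) * \<eta>' \<le> real (Suc N) * \<eta>'" using i \<eta>' by (intro mult_right_mono) auto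
      moreover have "real (Suc N) * \<eta>' = \<eta>" by (simp add: \<eta>'_def)
      ultimately show ?thesis using squeezed_mono by metis
    qed
    ultimately show "\<exists>c :: 'a \<Rightarrow> nat. range c \<subseteq> {..<N} \<and> (\<forall>x y. c x = c y \<longrightarrow> dist x y < \<rho>) \<and>
       (\<forall>i<N. squeezed \<eta> {x. c x = i})" using c(1) by (intro exI[of _ c]) auto
  qed
qed

end

section \<open>Matching distance against Birkhoff averages\<close>

lemma matching_dist_bdd_below:
  "bdd_below ((\<lambda>\<sigma>. 1 / real n * (\<Sum>k=1..n. dist ((T ^^ k) x) ((T ^^ \<sigma> k) y))) ` S)"
  by (rule bdd_belowI2[of _ 0]) (simp add: sum_nonneg)

lemma matching_dist_le:
  "\<sigma> permutes {1..n} \<Longrightarrow> matching_dist T n x y \<le> 1 / real n * (\<Sum>k=1..n. dist ((T ^^ k) x) ((T ^^ \<sigma> k) y))"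
  unfolding matching_dist_def by (rule cINF_lower[OF matching_dist_bdd_below]) simp

lemma matching_dist_greatest:
  "(\<And>\<sigma>. \<sigma> permutes {1..n} \<Longrightarrow> b \<le> 1 / real n * (\<Sum>k=1..n. dist ((T ^^ k) x) ((T ^^ \<sigma> k) y))) \<Longrightarrow>
    b \<le> matching_dist T n x y"
  unfolding matching_dist_def by (rule cINF_greatest) (auto intro: permutes_id)

lemma matching_dist_nonneg: "0 \<le> matching_dist T n x y"
  by (rule matching_dist_greatest) (simp add: sum_nonneg)

text \<open>Reordering the orbit of \<open>y\<close> does not change its Birkhoff sums, so every
  permutation yields the bound, and so does their infimum. The affine modulus
  \<open>e + C * dist a b\<close> stands in for a Lipschitz condition, which a continuous
  \<open>f\<close> need not satisfy.\<close>

lemma birkhoff_avg_diff_le_matching_dist: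
  fixes T :: "'a::metric_space \<Rightarrow> 'a"
  assumes C: "0 < C" and e: "0 \<le> e" and f: "\<And>a b. \<bar>f a - f b\<bar> \<le> e + C * dist a b"
  shows "\<bar>birkhoff_avg T f x n - birkhoff_avg T f y n\<bar> \<le> e + C * matching_dist T n x y"
proof -
  have "(\<bar>birkhoff_avg T f x n - birkhoff_avg T f y n\<bar> - e) / C \<le> matching_dist T n x y"
  proof (rule matching_dist_greatest)
    fix \<sigma> assume \<sigma>: "\<sigma> permutes {1..n}"
    define D where "D = (\<Sum>k=1..n. dist ((T ^^ k) x) ((T ^^ \<sigma> k) y))"
    have "(\<Sum>k=1..n. f ((T ^^ k) y)) = (\<Sum>k=1..n. f ((T ^^ \<sigma> k) y))"
      using sum.permute[OF \<sigma>, of "\<lambda>k. f ((T ^^ k) y)"] by (simp add: comp_def)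
    then have "birkhoff_avg T f x n - birkhoff_avg T f y n = 1 / real n * (\<Sum>k=1..n. f ((T ^^ k) x) - f ((T ^^ \<sigma> k) y))"
      by (simp add: birkhoff_avg_def sum_subtractf diff_divide_distrib)
    then have "\<bar>birkhoff_avg T f x n - birkhoff_avg T f y n\<bar> = 1 / real n * \<bar>\<Sum>k=1..n. f ((T ^^ k) x) - f ((T ^^ \<sigma> k) y)\<bar>"
      by (simp add: abs_mult)
    also have "\<dots> \<le> 1 / real n * (\<Sum>k=1..n. e + C * dist ((T ^^ k) x) ((T ^^ \<sigma> k) y))"
      by (intro mult_left_mono order_trans[OF sum_abs] sum_mono f) auto
    also have "\<dots> = 1 / real n * (real n * e) + C * (1 / real n * D)"
      by (simp add: sum.distrib sum_distrib_left[symmetric] D_def add_divide_distrib)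
    \<comment> \<open>For \<open>n = 0\<close> the first summand is 0 and not \<open>e\<close>;
      nonnegativity of \<open>e\<close> covers this case.\<close>
    also have "\<dots> \<le> e + C * (1 / real n * D)" using e by simp
    finally show "(\<bar>birkhoff_avg T f x n - birkhoff_avg T f y n\<bar> - e) / C \<le> 1 / real n * D"
      using C by (simp add: pos_divide_le_eq mult.commute)
  qed
  then show ?thesis using C by (simp add: pos_divide_le_eq mult.commute)
qed

text \<open>If two limits differ by \<open>D > 0\<close>, the averages eventually differ by more
  than \<open>D / 2\<close>. An affine modulus with constant term \<open>D / 4\<close> then keeps
  the matching distance above \<open>D / (4 * C)\<close>, and the lower limit is positive.\<close>

lemma same_limits_if_F_lower_zero:
  fixes T :: "'a::metric_space \<Rightarrow> 'a"
  assumes c: "compact (UNIV :: 'a set)" and x: "x \<in> generic_points T" and y: "y \<in> generic_points T"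
    and F: "F_lower T x y = 0"
  shows "(x, y) \<in> same_limits T"
proof -
  have "lim (birkhoff_avg T f x) = lim (birkhoff_avg T f y)" if f: "continuous_on UNIV f" for f
  proof (rule ccontr)
    assume ne: "lim (birkhoff_avg T f x) \<noteq> lim (birkhoff_avg T f y)"
    define D where "D = \<bar>lim (birkhoff_avg T f x) - lim (birkhoff_avg T f y)\<bar>"
    have D: "0 < D" using ne by (simp add: D_def)
    obtain B0 where B0: "\<And>x. norm (f x) \<le> B0"
      using compact_imp_bounded[OF compact_continuous_image[OF f c]] by (auto simp: bounded_iff)
    define B where "B = max 1 B0"
    have B: "0 < B" "\<And>x. \<bar>f x\<bar> \<le> B" using B0 by (auto simp: B_def intro: le_max_iff_disj[THEN iffD2])
    have "0 < D / 4" using D by simp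
    then obtain \<delta> where \<delta>: "0 < \<delta>" "\<And>a b. dist a b < \<delta> \<Longrightarrow> dist (f a) (f b) < D / 4"
      using compact_uniformly_continuous[OF f c] unfolding uniformly_continuous_on_def
      by (metis UNIV_I)
    \<comment> \<open>At distances below \<open>\<delta>\<close> uniform continuity gives the
      modulus; beyond, \<open>C\<close> times the distance is at least \<open>2 * B\<close> and so
      bounds any difference of values.\<close>
    define C where "C = 2 * B / \<delta>"
    have C: "0 < C" using B \<delta> by (simp add: C_def)
    have mod: "\<bar>f a - f b\<bar> \<le> D / 4 + C * dist a b" for a b
    proof (cases "dist a b < \<delta>")
      case True
      have "0 \<le> C * dist a b" using C by simp
      then show ?thesis using \<delta>(2)[OF True] unfolding dist_real_def by linarith
    next
      case False
      then have "C * \<delta> \<le> C * dist a b" using C by (intro mult_left_mono) auto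
      moreover have "C * \<delta> = 2 * B" using \<delta> by (simp add: C_def)
      ultimately show ?thesis using B(2)[of a] B(2)[of b] D by linarith
    qed
    have "(\<lambda>n. \<bar>birkhoff_avg T f x n - birkhoff_avg T f y n\<bar>) \<longlonglongrightarrow> D"
      unfolding D_def using generic_pointsD[OF x f] generic_pointsD[OF y f] by (intro tendsto_intros)
    then have "eventually (\<lambda>n. D / 2 < \<bar>birkhoff_avg T f x n - birkhoff_avg T f y n\<bar>) sequentially"
      by (rule order_tendstoD) (use D in simp)
    then have "eventually (\<lambda>n. ereal (D / (4 * C)) \<le> ereal (matching_dist T n x y)) sequentially"
    proof eventually_elim
      case (elim n)
      then have "D / 2 < D / 4 + C * matching_dist T n x y"
        using birkhoff_avg_diff_le_matching_dist[OF C _ mod, of T x n y] D by simp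
      then show ?case using C by (simp add: field_simps)
    qed
    then have "ereal (D / (4 * C)) \<le> F_lower T x y"
      unfolding F_lower_def by (rule Liminf_bounded)
    then show False using F C D by (simp add: field_simps zero_ereal_def)
  qed
  then show ?thesis using x y by (simp add: same_limits_def)
qed

lemma matching_dist_tendsto_zero:
  fixes T :: "'a::metric_space \<Rightarrow> 'a"
  assumes c: "compact (UNIV :: 'a set)" and xy: "(x, y) \<in> same_limits T"
  shows "(\<lambda>n. matching_dist T n x y) \<longlonglongrightarrow> 0"
proof -
  from xy have x: "x \<in> generic_points T" and y: "y \<in> generic_points T"
    and eq: "\<And>f. continuous_on UNIV f \<Longrightarrow> lim (birkhoff_avg T f x) = lim (birkhoff_avg T f y)"
    by (auto simp: same_limits_def)
  interpret normalized_positive_functional "\<lambda>f. lim (birkhoff_avg T f x)"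
    by (rule birkhoff_limit_functional[OF c x])
  obtain B where B: "0 < B" "\<And>a b :: 'a. dist a b \<le> B"
    using compact_imp_bounded[OF c] unfolding bounded_two_points
    by (metis UNIV_I less_max_iff_disj max.cobounded1 order_trans zero_less_one)
  have "eventually (\<lambda>n. matching_dist T n x y < e) sequentially" if e: "0 < e" for e
  proof -
    have "0 < e / 2" using e by simp
    then obtain N :: nat where N: "\<And>\<eta>::real. 0 < \<eta> \<Longrightarrow> \<exists>c :: 'a \<Rightarrow> nat. range c \<subseteq> {..<N} \<and>
       (\<forall>x y. c x = c y \<longrightarrow> dist x y < e / 2) \<and> (\<forall>i<N. squeezed \<eta> {x. c x = i})"
      using ex_squeezed_partition by metis
    \<comment> \<open>Each of the \<open>N\<close> pieces contributes at most
      \<open>2 * \<eta> * n\<close> mismatches, each costing at most \<open>B\<close>. This totals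
      at most \<open>n * e / 4\<close>, within the \<open>n * e / 2\<close> left over by the matched
      times. \<open>Suc N\<close> keeps the denominator positive.\<close>
    define \<eta> where "\<eta> = e / (8 * B * real (Suc N))"
    have \<eta>: "0 < \<eta>" using e B by (simp add: \<eta>_def)
    from N[OF this] obtain c :: "'a \<Rightarrow> nat" where cN: "range c \<subseteq> {..<N}"
      and cd: "\<And>x y. c x = c y \<Longrightarrow> dist x y < e / 2" and cs: "\<And>i. i < N \<Longrightarrow> squeezed \<eta> {x. c x = i}" by metis
    define cnt where "cnt z n i = real (card {k\<in>{1..n}. c ((T ^^ k) z) = i})" for z n i
    have cnt_avg: "cnt z n i / real n = birkhoff_avg T (indicator {x. c x = i}) z n" for z n i
      by (simp add: cnt_def birkhoff_avg_def indicator_def sum.If_cases Int_def)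
    have freq: "eventually (\<lambda>n. \<bar>cnt x n i - cnt y n i\<bar> \<le> 2 * \<eta> * real n) sequentially" if i: "i < N" for i
    proof -
      from cs[OF i] obtain g h where gh: "continuous_on UNIV g" "continuous_on UNIV h"
        "\<And>z. g z \<le> indicator {x. c x = i} z" "\<And>z. indicator {x. c x = i} z \<le> h z"
        "lim (birkhoff_avg T h x) - lim (birkhoff_avg T g x) \<le> \<eta>"
        by (auto simp: squeezed_def)
      \<comment> \<open>The upper function is averaged along one orbit and the lower one along the
        other. As the limits agree on both orbits, each gap tends to at most \<open>\<eta>\<close>,
        and it bounds the difference of visit frequencies in one direction.\<close>
      have "(\<lambda>n. birkhoff_avg T h x n - birkhoff_avg T g y n) \<longlonglongrightarrow> lim (birkhoff_avg T h x) - lim (birkhoff_avg T g y)"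
        "(\<lambda>n. birkhoff_avg T h y n - birkhoff_avg T g x n) \<longlonglongrightarrow> lim (birkhoff_avg T h y) - lim (birkhoff_avg T g x)"
        using gh x y by (intro tendsto_diff generic_pointsD; simp)+
      moreover have "lim (birkhoff_avg T h x) - lim (birkhoff_avg T g y) < 2 * \<eta>"
        "lim (birkhoff_avg T h y) - lim (birkhoff_avg T g x) < 2 * \<eta>"
        using gh(5) eq[OF gh(1)] eq[OF gh(2)] \<eta> by linarith+
      ultimately have
        "eventually (\<lambda>n. birkhoff_avg T h x n - birkhoff_avg T g y n < 2 * \<eta>) sequentially"
        "eventually (\<lambda>n. birkhoff_avg T h y n - birkhoff_avg T g x n < 2 * \<eta>) sequentially"
        by (auto dest: order_tendstoD(2))
      then show ?thesis
        using eventually_gt_at_top[of 0]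
      proof eventually_elim
        case (elim n)
        have "birkhoff_avg T g z n \<le> cnt z n i / real n" "cnt z n i / real n \<le> birkhoff_avg T h z n" for z
          unfolding cnt_avg by (intro birkhoff_avg_mono gh)+
        from this[of x] this[of y] elim have "\<bar>cnt x n i / real n - cnt y n i / real n\<bar> \<le> 2 * \<eta>" by linarith
        then have "\<bar>cnt x n i - cnt y n i\<bar> / real n \<le> 2 * \<eta>"
          by (simp add: diff_divide_distrib[symmetric])
        then show ?case using elim by (simp add: pos_divide_le_eq)
      qed
    qed
    have "eventually (\<lambda>n. \<forall>i\<in>{..<N}. \<bar>cnt x n i - cnt y n i\<bar> \<le> 2 * \<eta> * real n) sequentially"
      using freq by (intro eventually_ball_finite) auto
    then show ?thesis
      using eventually_gt_at_top[of 0]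
    proof eventually_elim
      case (elim n)
      obtain \<sigma> where \<sigma>: "\<sigma> permutes {1..n}"
        "real (card {k\<in>{1..n}. c ((T ^^ k) x) \<noteq> c ((T ^^ \<sigma> k) y)}) \<le> (\<Sum>i<N. \<bar>cnt x n i - cnt y n i\<bar>)"
        unfolding cnt_def
        by (rule ex_permutation_few_mismatches[of "{..<N}" "\<lambda>k. c ((T ^^ k) x)" n "\<lambda>k. c ((T ^^ k) y)"])
          (use cN in auto)
      define M where "M = {k\<in>{1..n}. c ((T ^^ k) x) \<noteq> c ((T ^^ \<sigma> k) y)}"
      have "(\<Sum>i<N. \<bar>cnt x n i - cnt y n i\<bar>) \<le> (\<Sum>i<N. 2 * \<eta> * real n)" using elim by (intro sum_mono) auto
      with \<sigma>(2) have M: "real (card M) \<le> real N * (2 * \<eta> * real n)" by (simp add: M_def)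
      have "(\<Sum>k=1..n. dist ((T ^^ k) x) ((T ^^ \<sigma> k) y)) \<le> (\<Sum>k=1..n. e / 2 + B * indicator M k)"
      proof (rule sum_mono)
        fix k assume k: "k \<in> {1..n}"
        show "dist ((T ^^ k) x) ((T ^^ \<sigma> k) y) \<le> e / 2 + B * indicator M k"
        proof (cases "k \<in> M")
          case True
          then show ?thesis using B(2)[of "(T ^^ k) x" "(T ^^ \<sigma> k) y"] e by simp
        next
          case False
          then show ?thesis using cd[of "(T ^^ k) x" "(T ^^ \<sigma> k) y"] k by (auto simp: M_def)
        qed
      qed
      also have "\<dots> = real n * (e / 2) + B * real (card M)"
      proof -
        have "{1..n} \<inter> M = M" by (auto simp: M_def)
        then show ?thesis by (simp add: sum.distrib sum_distrib_left[symmetric] indicator_def sum.If_cases)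
      qed
      also have "\<dots> \<le> real n * (e / 2) + B * (real N * (2 * \<eta> * real n))"
        using B M by simp
      also have "\<dots> < real n * e"
      proof -
        have "B * (real N * (2 * \<eta> * real n)) \<le> B * (real (Suc N) * (2 * \<eta> * real n))"
          using B \<eta> by (intro mult_left_mono mult_right_mono) auto
        also have "\<dots> = real n * (e / 4)" using B by (simp add: \<eta>_def)
        also have "\<dots> < real n * (e / 2)" using e elim by simp
        finally show ?thesis by (simp add: algebra_simps)
      qed
      finally have "1 / real n * (\<Sum>k=1..n. dist ((T ^^ k) x) ((T ^^ \<sigma> k) y)) < e"
        using elim by (simp add: pos_divide_less_eq mult.commute)
      then show ?case using matching_dist_le[OF \<sigma>(1)] by (rule le_less_trans[rotated])
    qed
  qed
  then show ?thesis
    by (intro order_tendstoI) (auto intro: less_le_trans[OF _ matching_dist_nonneg] eventuallyI)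
qed

section \<open>Identification of the sets and conclusion by Fubini\<close>

text \<open>A cycle of three inclusions. The two intersections thereby inherit the measurability of
  \<open>same_limits T\<close>.\<close>

lemma N_F_Int_generic_points:
  fixes T :: "'a::metric_space \<Rightarrow> 'a"
  assumes c: "compact (UNIV :: 'a set)"
  shows "N_F T \<inter> (generic_points T \<times> generic_points T) = same_limits T"
    and "N_F_lower T \<inter> (generic_points T \<times> generic_points T) = same_limits T"
proof -
  have "same_limits T \<subseteq> N_F T \<inter> (generic_points T \<times> generic_points T)"
  proof
    fix p assume p: "p \<in> same_limits T"
    obtain x y where xy: "p = (x, y)" by force
    have "(\<lambda>n. ereal (matching_dist T n x y)) \<longlonglongrightarrow> ereal 0"
      using matching_dist_tendsto_zero[OF c] p xy by (intro tendsto_ereal) auto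
    from lim_imp_Liminf[OF sequentially_bot this] lim_imp_Limsup[OF sequentially_bot this]
    have "F_lower T x y = 0" "F_upper T x y = 0"
      by (simp_all add: F_lower_def F_upper_def)
    then show "p \<in> N_F T \<inter> (generic_points T \<times> generic_points T)"
      using p xy by (auto simp: N_F_def F_exists_def F_value_def same_limits_def)
  qed
  moreover have "N_F T \<subseteq> N_F_lower T"
    by (auto simp: N_F_def N_F_lower_def F_exists_def F_value_def)
  moreover have "N_F_lower T \<inter> (generic_points T \<times> generic_points T) \<subseteq> same_limits T"
    using same_limits_if_F_lower_zero[OF c] by (auto simp: N_F_lower_def)
  ultimately show "N_F T \<inter> (generic_points T \<times> generic_points T) = same_limits T"
    "N_F_lower T \<inter> (generic_points T \<times> generic_points T) = same_limits T" by blast+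
qed

text \<open>Forward, the relation contains the square of a basin of positive measure. Backward, if
  all sections were null, so would be the relation; a section of positive measure is a
  basin.\<close>

lemma ex_physical_measure_iff:
  fixes T :: "'a::metric_space \<Rightarrow> 'a"
  assumes c: "compact (UNIV :: 'a set)" and T: "continuous_on UNIV T"
    and "prob_space m" and sets: "sets m = sets borel"
  shows "(\<exists>\<mu>. physical_measure T m \<mu>) \<longleftrightarrow> emeasure (m \<Otimes>\<^sub>M m) (same_limits T) > 0"
proof -
  interpret m: prob_space m by fact
  have E: "same_limits T \<in> sets (m \<Otimes>\<^sub>M m)" by (rule same_limits_measurable[OF c T sets])
  show ?thesis
  proof
    assume "\<exists>\<mu>. physical_measure T m \<mu>"
    then obtain \<mu> where \<mu>: "emeasure m (basin T \<mu>) > 0" by (auto simp: physical_measure_def)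
    then have "basin T \<mu> \<noteq> {}" by (intro notI) simp
    then obtain x where x: "x \<in> basin T \<mu>" by blast
    have B: "basin T \<mu> \<in> sets m"
      unfolding basin_eq_section[OF c x] by (rule sets_Pair1[OF E])
    have "basin T \<mu> \<times> basin T \<mu> \<subseteq> same_limits T"
      using basin_eq_section[OF c] by blast
    then have "emeasure (m \<Otimes>\<^sub>M m) (basin T \<mu> \<times> basin T \<mu>) \<le> emeasure (m \<Otimes>\<^sub>M m) (same_limits T)"
      by (rule emeasure_mono[OF _ E])
    moreover have "emeasure (m \<Otimes>\<^sub>M m) (basin T \<mu> \<times> basin T \<mu>) > 0"
      using \<mu> by (simp add: m.emeasure_pair_measure_Times[OF B B] ennreal_zero_less_mult_iff)
    ultimately show "emeasure (m \<Otimes>\<^sub>M m) (same_limits T) > 0" by simp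
  next
    assume pos: "emeasure (m \<Otimes>\<^sub>M m) (same_limits T) > 0"
    have fubini: "emeasure (m \<Otimes>\<^sub>M m) (same_limits T) = (\<integral>\<^sup>+x. emeasure m (Pair x -` same_limits T) \<partial>m)"
      by (rule m.emeasure_pair_measure_alt[OF E])
    have "\<not> (\<forall>x. emeasure m (Pair x -` same_limits T) = 0)"
    proof (intro notI)
      assume "\<forall>x. emeasure m (Pair x -` same_limits T) = 0"
      with pos show False unfolding fubini by simp
    qed
    then obtain x where x: "emeasure m (Pair x -` same_limits T) > 0"
      using not_gr_zero by blast
    \<comment> \<open>Positivity is used again here: a nonempty section forces \<open>x\<close> to
      be generic, which supplies the measure \<open>\<mu>\<close>.\<close>
    then have "Pair x -` same_limits T \<noteq> {}" by (intro notI) simp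
    then obtain y where "(x, y) \<in> same_limits T" by blast
    then have "x \<in> generic_points T" by (simp add: same_limits_def)
    then obtain \<mu> where \<mu>: "\<mu> \<in> invariant_measures T" "x \<in> basin T \<mu>"
      using ex_invariant_measure_of_generic[OF c T] by metis
    with x show "\<exists>\<mu>. physical_measure T m \<mu>"
      using basin_eq_section[OF c \<mu>(2)] by (auto simp: physical_measure_def)
  qed
qed

theorem theorem5p5:
  fixes T :: "'a::metric_space \<Rightarrow> 'a" and m :: "'a measure"
  assumes "compact (UNIV :: 'a set)"
    and "continuous_on UNIV T"
    and "m \<in> prob_measures"
  shows "((\<exists>\<mu>. physical_measure T m \<mu>) \<longleftrightarrow>
            emeasure (m \<Otimes>\<^sub>M m) (N_F T \<inter> (generic_points T \<times> generic_points T)) > 0) \<and>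
         (emeasure (m \<Otimes>\<^sub>M m) (N_F T \<inter> (generic_points T \<times> generic_points T)) > 0 \<longleftrightarrow>
            emeasure (m \<Otimes>\<^sub>M m) (N_F_lower T \<inter> (generic_points T \<times> generic_points T)) > 0)"
proof -
  have "prob_space m" "sets m = sets borel"
    using assms(3) by (auto simp: prob_measures_def regular_borel_measure_def)
  then show ?thesis
    using ex_physical_measure_iff[OF assms(1,2)] by (simp add: N_F_Int_generic_points[OF assms(1)])
qed

end
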